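(* Let $2\le p<\infty$ and let $X$ be a (closed) subspace of a quotient of $L_p=L_p[0,1]$. Suppose that $X$ has a $1$-unconditional finite-dimensional Schauder decomposition, or merely that $X$ has the unconditional metric compact approximation property. Then $K(X,\ell_p)$ is an $M$-ideal in $L(X,\ell_p)$.
   Context: For Banach spaces $X,Y$, $L(X,Y)$ denotes the Banach space of bounded linear operators from $X$ to $Y$ with the operator norm, and $K(X,Y)$ its closed subspace of compact operators. A closed subspace $J$ of a Banach space $E$ is called an $M$-ideal in $E$ if there is a closed subspace $V$ of $E^*$ such that $E^*=J^\perp\oplus_1 V$, where $J^\perp=\{e^*\in E^*: e^*|_J=0\}$ and $\oplus_1$ means that $E^*$ is the direct sum of $J^\perp$ and $V$ with $\|u+v\|=\|u\|+\|v\|$ for all $u\in J^\perp$, $v\in V$. "Subspace of a quotient of $L_p$" means that $X$ is isometric to a closed subspace of a quotient space $L_p/Z$ with $Z\subset L_p$ a closed subspace, with the quotient norm. A $1$-unconditional finite-dimensional Schauder decomposition of $X$ is a sequence $(X_n)$ of finite-dimensional subspaces of $X$ such that each $x\in X$ has a unique representation as a norm-convergent series $x=\sum_n x_n$ with $x_n\in X_n$, and such that for every $x=\sum_n x_n$ and every choice of signs $\theta_n\in\{-1,1\}$ the series $\sum_n\theta_n x_n$ converges and $\|\sum_n\theta_n x_n\|=\|\sum_n x_n\|$. $X$ has the unconditional metric compact approximation property if there is a sequence of compact operators $K_n\colon X\to X$ such that $K_n x\to x$ for all $x\in X$ and $\|\mathrm{Id}_X-2K_n\|\to 1$. *)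

theory Defs
  imports "HOL-Analysis.Analysis" "HOL-Library.Function_Algebras"
begin

section \<open>Real and complex Banach spaces at once\<close>

text \<open>
  The scalar field is a type of class \<open>{real_normed_field, euclidean_space}\<close>; up to isomorphism
  these are exactly the reals and the complex numbers.  A Banach space over it is a type of class
  \<open>banach\<close> together with a scalar multiplication extending the real one.
\<close>

locale banach_over = vector_space smul
  for smul :: "'k::{real_normed_field, euclidean_space} \<Rightarrow> 'a::banach \<Rightarrow> 'a" +
  assumes norm_scale: "norm (smul c x) = norm c * norm x"
    and scale_of_real: "smul (of_real r) x = r *\<^sub>R x"

lemma banach_over_real: "banach_over (scaleR :: real \<Rightarrow> 'a::banach \<Rightarrow> 'a)"
  by unfold_locales (auto simp: algebra_simps)

lemma banach_over_complex: "banach_over ((*) :: complex \<Rightarrow> complex \<Rightarrow> complex)"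
  by unfold_locales (auto simp: algebra_simps norm_mult scaleR_conv_of_real)

section \<open>Normed spaces on a carrier set\<close>

text \<open>
  The spaces \<open>\<ell>\<^sub>p\<close>, \<open>L\<^sub>p\<close> and their spaces of operators depend on the real number \<open>p\<close>, so they are not
  types.  They are given by a carrier set, a scalar multiplication and a norm; addition is that of
  the ambient type (pointwise on functions, elementwise on sets).
\<close>

record ('k, 'v) nspace =
  carr :: "'v set"
  scl :: "'k \<Rightarrow> 'v \<Rightarrow> 'v"
  nrm :: "'v \<Rightarrow> real"

definition type_space :: "('k \<Rightarrow> 'a \<Rightarrow> 'a) \<Rightarrow> ('k, 'a::real_normed_vector) nspace" where
  "type_space smul = \<lparr>carr = UNIV, scl = smul, nrm = norm\<rparr>"

definition closed_subspace :: "('k::field, 'v::ab_group_add) nspace \<Rightarrow> 'v set \<Rightarrow> bool" where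
  "closed_subspace E Z \<longleftrightarrow> Z \<subseteq> carr E \<and> module.subspace (scl E) Z \<and>
     (\<forall>z x. (\<forall>n. z n \<in> Z) \<and> x \<in> carr E \<and> (\<lambda>n::nat. nrm E (z n - x)) \<longlonglongrightarrow> 0 \<longrightarrow> x \<in> Z)"

definition linear_map ::
  "('k, 'v::plus) nspace \<Rightarrow> ('k, 'w::plus) nspace \<Rightarrow> ('v \<Rightarrow> 'w) \<Rightarrow> bool" where
  "linear_map E F T \<longleftrightarrow> (\<forall>x\<in>carr E. T x \<in> carr F) \<and>
     (\<forall>x\<in>carr E. \<forall>y\<in>carr E. T (x + y) = T x + T y) \<and>
     (\<forall>c. \<forall>x\<in>carr E. T (scl E c x) = scl F c (T x))"

definition op_norm :: "('k, 'v) nspace \<Rightarrow> ('k, 'w) nspace \<Rightarrow> ('v \<Rightarrow> 'w) \<Rightarrow> real" where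
  "op_norm E F T = (SUP x\<in>{x\<in>carr E. nrm E x \<le> 1}. nrm F (T x))"

text \<open>An operator is set to \<open>0\<close> outside the carrier, so that it is determined by its values there.\<close>

definition op_space ::
  "('k, 'v::ab_group_add) nspace \<Rightarrow> ('k, 'w::ab_group_add) nspace \<Rightarrow> ('k, 'v \<Rightarrow> 'w) nspace" where
  "op_space E F =
     \<lparr>carr = {T. linear_map E F T \<and> (\<exists>C. \<forall>x\<in>carr E. nrm F (T x) \<le> C * nrm E x) \<and>
                 (\<forall>x. x \<notin> carr E \<longrightarrow> T x = 0)},
      scl = (\<lambda>c T x. scl F c (T x)),
      nrm = op_norm E F\<rparr>"

definition compact_ops ::
  "('k, 'v::ab_group_add) nspace \<Rightarrow> ('k, 'w::ab_group_add) nspace \<Rightarrow> ('v \<Rightarrow> 'w) set" where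
  "compact_ops E F = {T \<in> carr (op_space E F).
     \<forall>x. (\<forall>n::nat. x n \<in> carr E \<and> nrm E (x n) \<le> 1) \<longrightarrow>
       (\<exists>y\<in>carr F. \<exists>r. strict_mono r \<and> (\<lambda>n. nrm F (T (x (r n)) - y)) \<longlonglongrightarrow> 0)}"

definition dual :: "('k::real_normed_field, 'v::ab_group_add) nspace \<Rightarrow> ('k, 'v \<Rightarrow> 'k) nspace" where
  "dual E = op_space E (type_space (*))"

definition annihilator ::
  "('k::real_normed_field, 'v::ab_group_add) nspace \<Rightarrow> 'v set \<Rightarrow> ('v \<Rightarrow> 'k) set" where
  "annihilator E J = {u \<in> carr (dual E). \<forall>x\<in>J. u x = 0}"

definition M_ideal :: "('k::real_normed_field, 'v::ab_group_add) nspace \<Rightarrow> 'v set \<Rightarrow> bool" where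
  "M_ideal E J \<longleftrightarrow> closed_subspace E J \<and>
     (\<exists>V. closed_subspace (dual E) V \<and>
        annihilator E J \<inter> V = {0} \<and>
        carr (dual E) = {u + v |u v. u \<in> annihilator E J \<and> v \<in> V} \<and>
        (\<forall>u\<in>annihilator E J. \<forall>v\<in>V.
           nrm (dual E) (u + v) = nrm (dual E) u + nrm (dual E) v))"

section \<open>The spaces \<open>\<ell>\<^sub>p\<close> and \<open>L\<^sub>p[0,1]\<close>, and quotients\<close>

definition ell :: "real \<Rightarrow> ('k::real_normed_field, nat \<Rightarrow> 'k) nspace" where
  "ell p =
     \<lparr>carr = {a. summable (\<lambda>i. norm (a i) powr p)},
      scl = (\<lambda>c a i. c * a i),
      nrm = (\<lambda>a. (\<Sum>i. norm (a i) powr p) powr (1 / p))\<rparr>"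

text \<open>
  Functions are not identified almost everywhere here, so \<open>nrm (Lp p)\<close> is only a seminorm.  A closed
  subspace \<open>Z\<close> contains every function of seminorm \<open>0\<close>; hence closed subspaces of \<open>Lp p\<close> correspond
  to those of the Banach space \<open>L\<^sub>p[0,1]\<close>, and \<open>quotient_space (Lp p) Z\<close> is the Banach space quotient.
\<close>

definition Lp :: "real \<Rightarrow> ('k::{real_normed_field, euclidean_space}, real \<Rightarrow> 'k) nspace" where
  "Lp p =
     \<lparr>carr = {f \<in> borel_measurable (lebesgue_on {0..1}).
                integrable (lebesgue_on {0..1}) (\<lambda>t. norm (f t) powr p)},
      scl = (\<lambda>c f t. c * f t),
      nrm = (\<lambda>f. (LINT t|lebesgue_on {0..1}. norm (f t) powr p) powr (1 / p))\<rparr>"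

text \<open>
  The points are the cosets \<open>x + Z\<close>.  The summand \<open>Z\<close> in the scalar multiplication only matters for
  the scalar \<open>0\<close>, where \<open>scl E 0 ` C\<close> is \<open>{0}\<close> instead of \<open>Z\<close>.
\<close>

definition quotient_space ::
  "('k, 'v::ab_group_add) nspace \<Rightarrow> 'v set \<Rightarrow> ('k, 'v set) nspace" where
  "quotient_space E Z =
     \<lparr>carr = {x +o Z |x. x \<in> carr E},
      scl = (\<lambda>c C. scl E c ` C + Z),
      nrm = (\<lambda>C. INF x\<in>C. nrm E x)\<rparr>"

text \<open>The range of the isometry is automatically closed because \<open>'a\<close> is complete.\<close>

definition subspace_of_quotient_of_Lp ::
  "real \<Rightarrow> ('k::{real_normed_field, euclidean_space} \<Rightarrow> 'a::banach \<Rightarrow> 'a) \<Rightarrow> bool" where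
  "subspace_of_quotient_of_Lp p smul \<longleftrightarrow>
     (\<exists>Z. closed_subspace (Lp p) Z \<and>
       (\<exists>J. linear_map (type_space smul) (quotient_space (Lp p) Z) J \<and>
            (\<forall>x. nrm (quotient_space (Lp p) Z) (J x) = norm x)))"

section \<open>Approximation properties\<close>

definition unconditional_FDD :: "('k::field \<Rightarrow> 'a::banach \<Rightarrow> 'a) \<Rightarrow> (nat \<Rightarrow> 'a set) \<Rightarrow> bool" where
  "unconditional_FDD smul X \<longleftrightarrow>
     (\<forall>n. \<exists>B. finite B \<and> X n = module.span smul B) \<and>
     (\<forall>x. \<exists>!a. (\<forall>n. a n \<in> X n) \<and> a sums x) \<and>
     (\<forall>x a \<theta>. (\<forall>n. a n \<in> X n) \<and> a sums x \<and> (\<forall>n. \<theta> n \<in> {-1, 1::real}) \<longrightarrow>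
        summable (\<lambda>n. \<theta> n *\<^sub>R a n) \<and> norm (\<Sum>n. \<theta> n *\<^sub>R a n) = norm x)"

definition UMCAP :: "('k::field \<Rightarrow> 'a::banach \<Rightarrow> 'a) \<Rightarrow> bool" where
  "UMCAP smul \<longleftrightarrow>
     (\<exists>K. (\<forall>n::nat. K n \<in> compact_ops (type_space smul) (type_space smul)) \<and>
          (\<forall>x. (\<lambda>n. K n x) \<longlonglongrightarrow> x) \<and>
          (\<lambda>n. onorm (\<lambda>x. x - 2 *\<^sub>R K n x)) \<longlonglongrightarrow> 1)"

end

theory Submission
  imports Defs "HOL-Complex_Analysis.Great_Picard"
begin

text \<open>
  Clarkson's inequality
  \<open>2 (\<parallel>x\<parallel>\<^sup>p + \<parallel>y\<parallel>\<^sup>p) \<le> \<parallel>x + y\<parallel>\<^sup>p + \<parallel>x - y\<parallel>\<^sup>p\<close> and the smoothness estimate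
  \<open>\<parallel>x + t y\<parallel> + \<parallel>x - t y\<parallel> \<le> 2 + O(t\<^sup>2)\<close> on the unit ball hold in \<open>L\<^sub>p\<close> for \<open>p \<ge> 2\<close>, because they hold for
  scalars, and both pass to subspaces and quotients.  Let \<open>K\<^sub>n\<close> be compact operators converging pointwise
  to the identity with \<open>\<parallel>1 - 2 K\<^sub>n\<parallel> \<rightarrow> 1\<close>.  Clarkson's inequality gives
  \<open>\<parallel>K\<^sub>n x\<parallel>\<^sup>p + \<parallel>x - K\<^sub>n x\<parallel>\<^sup>p \<le> (1 + o(1)) \<parallel>x\<parallel>\<^sup>p\<close>, and smoothness gives \<open>\<parallel>f - f K\<^sub>n\<parallel> \<rightarrow> 0\<close> for every
  functional \<open>f\<close>.  For \<open>T\<close> and a compact \<open>S\<close> in the unit ball of the operators into \<open>\<ell>\<^sub>p\<close> it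
  follows that, up to a small error, \<open>S\<close> is \<open>S K\<^sub>n\<close> with values in the first \<open>M\<close> coordinates, while
  \<open>T (1 - K\<^sub>n)\<close> takes values in the remaining ones; hence \<open>\<parallel>T (1 - K\<^sub>n) + S\<parallel> \<le> 1 + o(1)\<close>.  This makes
  \<open>\<phi> \<mapsto> (T \<mapsto> lim \<phi> (T K\<^sub>n))\<close> an \<open>L\<close>-projection whose kernel is the annihilator of the compact operators.
\<close>

section \<open>Inequalities for powers\<close>

text \<open>Convexity of the power function in tangent form. It is Young's inequality for the
  product of \<open>x\<close> and \<open>y powr (p - 1)\<close> with the conjugate exponents
  \<open>p\<close> and \<open>p / (p - 1)\<close>; the second exponent forces \<open>p = 1\<close>
  to be treated apart.\<close>

lemma powr_tangent:
  fixes x y p :: real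
  assumes "1 \<le> p" "0 \<le> x" "0 \<le> y"
  shows "y powr p + p * y powr (p - 1) * (x - y) \<le> x powr p"
proof (cases "p = 1")
  case True
  \<comment> \<open>Since \<open>0 powr 0 = 0\<close>, the slope at \<open>y = 0\<close> is
    \<open>0\<close> instead of \<open>1\<close>.\<close>
  then show ?thesis using assms by (cases "y = 0") auto
next
  case False
  with assms have p: "1 < p" by simp
  have "x * y powr (p - 1) \<le> x powr p / p + (y powr (p - 1)) powr (p / (p - 1)) / (p / (p - 1))"
    by (rule Youngs_inequality) (use p assms in \<open>auto simp: field_simps\<close>)
  also have "(y powr (p - 1)) powr (p / (p - 1)) = y powr p"
    using p by (simp add: powr_powr)
  finally have "p * (x * y powr (p - 1)) \<le> p * (x powr p / p + y powr p / (p / (p - 1)))"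
    using p by (intro mult_left_mono) auto
  also have "\<dots> = x powr p + (p - 1) * y powr p"
    using p by (simp add: field_simps)
  finally have *: "p * (x * y powr (p - 1)) \<le> x powr p + (p - 1) * y powr p" .
  have "y powr (p - 1) * y = y powr p"
    using assms powr_add[of y "p - 1" 1] by (cases "y = 0") auto
  then have "p * y powr (p - 1) * (x - y) = p * (x * y powr (p - 1)) - p * y powr p"
    by (simp add: algebra_simps)
  then show ?thesis using * by (simp only: left_diff_distrib)
qed

text \<open>Averaging the tangent inequalities at the point \<open>z = l * x + (1 - l) * y\<close>
  cancels the linear terms.\<close>

lemma powr_convex_nonneg:
  fixes x y l p :: real
  assumes "1 \<le> p" "0 \<le> x" "0 \<le> y" "0 \<le> l" "l \<le> 1"
  shows "(l * x + (1 - l) * y) powr p \<le> l * x powr p + (1 - l) * y powr p"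
proof -
  define z where "z = l * x + (1 - l) * y"
  define g where "g = p * z powr (p - 1)"
  have z: "0 \<le> z" using assms by (simp add: z_def)
  have "l * (z powr p + g * (x - z)) + (1 - l) * (z powr p + g * (y - z))
      \<le> l * x powr p + (1 - l) * y powr p"
    using powr_tangent[of p x z] powr_tangent[of p y z] assms z
    by (intro add_mono mult_left_mono) (auto simp: g_def)
  moreover have "l * (z powr p + g * (x - z)) + (1 - l) * (z powr p + g * (y - z)) = z powr p"
    by (simp add: z_def algebra_simps)
  ultimately show ?thesis by (simp add: z_def)
qed

text \<open>The sum is an even convex function of the increment, hence grows with it. Concretely,
  \<open>u + c\<close> and \<open>u - c\<close> are convex combinations of \<open>u + d\<close> and
  \<open>u - d\<close> with weights \<open>l\<close> and \<open>1 - l\<close>.\<close>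

lemma powr_even_mono:
  fixes u c d r :: real
  assumes "1 \<le> r" "0 \<le> c" "c \<le> d" "d \<le> u"
  shows "(u + c) powr r + (u - c) powr r \<le> (u + d) powr r + (u - d) powr r"
proof (cases "d = 0")
  case False
  with assms have d: "0 < d" by simp
  define l where "l = (d + c) / (2 * d)"
  have l: "0 \<le> l" "l \<le> 1" using assms d by (auto simp: l_def field_simps)
  have e: "l * (u + d) + (1 - l) * (u - d) = u + c" "l * (u - d) + (1 - l) * (u + d) = u - c"
    using d by (auto simp: l_def field_simps)
  show ?thesis
    using powr_convex_nonneg[of r "u + d" "u - d" l] powr_convex_nonneg[of r "u - d" "u + d" l] assms l
    unfolding e by (simp add: algebra_simps)
qed (use assms in auto)

text \<open>Split off one factor, \<open>z powr r = z * z powr (r - 1)\<close>, and enlarge the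
  remaining factor to its value at \<open>x + y\<close>.\<close>

lemma powr_superadditive:
  fixes x y r :: real
  assumes "1 \<le> r" "0 \<le> x" "0 \<le> y"
  shows "x powr r + y powr r \<le> (x + y) powr r"
proof -
  have split: "z powr r = z * z powr (r - 1)" if "0 \<le> z" for z :: real
    using that powr_add[of z 1 "r - 1"] by (cases "z = 0") auto
  have "x powr r + y powr r \<le> x * (x + y) powr (r - 1) + y * (x + y) powr (r - 1)"
    unfolding split[OF assms(2)] split[OF assms(3)] using assms
    by (intro add_mono mult_left_mono powr_mono2) auto
  also have "\<dots> = (x + y) powr r"
    using split[of "x + y"] assms by (simp add: algebra_simps)
  finally show ?thesis .
qed

lemma powr_add_le:
  fixes x y p :: real
  assumes "0 \<le> p" "0 \<le> x" "0 \<le> y"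
  shows "(x + y) powr p \<le> 2 powr p * (x powr p + y powr p)"
proof -
  have "(x + y) powr p \<le> (2 * max x y) powr p" using assms by (intro powr_mono2) auto
  also have "\<dots> = 2 powr p * max x y powr p" using assms by (simp add: powr_mult)
  also have "\<dots> \<le> 2 powr p * (x powr p + y powr p)" by (intro mult_left_mono) (auto simp: max_def)
  finally show ?thesis .
qed

text \<open>The sum of the constants from the two cases of the next estimate:
  \<open>2 * p * (p - 1)\<close> from second-order expansion, and \<open>2\<close> from bounding two
  powers separately. The factor \<open>2 powr p\<close> comes from
  \<open>powr_add_le\<close>.\<close>

definition smooth_const :: "real \<Rightarrow> real" where
  "smooth_const p = 2 powr p * (2 * p * (p - 1) + 2)"

lemma smooth_const_nonneg: "2 \<le> p \<Longrightarrow> 0 \<le> smooth_const p"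
  by (simp add: smooth_const_def)

text \<open>If \<open>t * B \<le> A\<close>, the second difference of the \<open>p\<close>-th power
  is of order \<open>t\<^sup>2 * B\<^sup>2 * (A + B) powr (p - 2)\<close>. Otherwise both powers on
  the left are already at most of order \<open>(t * B) powr p\<close>, and
  \<open>t powr p \<le> t\<^sup>2\<close> because \<open>p \<ge> 2\<close> and
  \<open>t \<le> 1\<close>.\<close>

lemma real_powr_smooth:
  fixes A B t p :: real
  assumes p: "2 \<le> p" and AB: "0 \<le> A" "0 \<le> B" and t: "0 \<le> t" "t \<le> 1"
  shows "(A + t * B) powr p + \<bar>A - t * B\<bar> powr p
    \<le> 2 * A powr p + smooth_const p * t\<^sup>2 * (A powr p + B powr p)"
proof (cases "t * B \<le> A")
  case True
  define Y where "Y = A + t * B"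
  define y where "y = A - t * B"
  have nn: "0 \<le> Y" "0 \<le> y" "0 \<le> t * B" using assms True by (auto simp: Y_def y_def)
  have "t * B \<le> B" using assms by (simp add: mult_left_le_one_le)
  then have YS: "Y \<le> A + B" by (simp add: Y_def)
  \<comment> \<open>The tangents at \<open>Y\<close> and \<open>y\<close>, evaluated at their
    midpoint \<open>A\<close>, leave a difference of two slopes. The tangent of the power
    \<open>p - 1\<close>, again convex, bounds that difference.\<close>
  have 1: "Y powr p + p * Y powr (p - 1) * (A - Y) \<le> A powr p"
      "y powr p + p * y powr (p - 1) * (A - y) \<le> A powr p"
      "Y powr (p - 1) + (p - 1) * Y powr (p - 1 - 1) * (y - Y) \<le> y powr (p - 1)"
    using nn assms powr_tangent[of p A Y] powr_tangent[of p A y] powr_tangent[of "p - 1" y Y] by auto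
  have "Y powr (p - 1) - y powr (p - 1) \<le> (p - 1) * Y powr (p - 2) * (2 * (t * B))"
    using 1(3) by (simp add: Y_def y_def algebra_simps)
  then have "p * (t * B) * (Y powr (p - 1) - y powr (p - 1))
      \<le> p * (t * B) * ((p - 1) * Y powr (p - 2) * (2 * (t * B)))"
    using nn p by (intro mult_left_mono) auto
  moreover have "Y powr p + y powr p \<le> 2 * A powr p + p * (t * B) * (Y powr (p - 1) - y powr (p - 1))"
    using 1(1,2) by (simp add: Y_def y_def algebra_simps)
  moreover have "p * (t * B) * ((p - 1) * Y powr (p - 2) * (2 * (t * B)))
      = 2 * p * (p - 1) * t\<^sup>2 * (B\<^sup>2 * Y powr (p - 2))"
    by (simp add: power2_eq_square algebra_simps)
  moreover have "B\<^sup>2 * Y powr (p - 2) \<le> 2 powr p * (A powr p + B powr p)"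
  proof -
    have "B\<^sup>2 * Y powr (p - 2) \<le> (A + B)\<^sup>2 * (A + B) powr (p - 2)"
      using AB nn YS p by (intro mult_mono power_mono powr_mono2) auto
    also have "\<dots> = (A + B) powr p"
      using AB powr_add[of "A + B" 2 "p - 2"] by (cases "A + B = 0") auto
    also have "\<dots> \<le> 2 powr p * (A powr p + B powr p)"
      using assms by (intro powr_add_le) auto
    finally show ?thesis .
  qed
  then have "2 * p * (p - 1) * t\<^sup>2 * (B\<^sup>2 * Y powr (p - 2))
      \<le> 2 * p * (p - 1) * t\<^sup>2 * (2 powr p * (A powr p + B powr p))"
    using p by (intro mult_left_mono) auto
  moreover have "2 * p * (p - 1) * t\<^sup>2 * (2 powr p * (A powr p + B powr p))
      \<le> smooth_const p * t\<^sup>2 * (A powr p + B powr p)"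
    by (simp add: smooth_const_def algebra_simps)
  ultimately have "Y powr p + y powr p \<le> 2 * A powr p + smooth_const p * t\<^sup>2 * (A powr p + B powr p)"
    by linarith
  then show ?thesis using nn by (simp add: Y_def y_def)
next
  case False
  have *: "z powr p \<le> 2 powr p * t\<^sup>2 * (A powr p + B powr p)" if "0 \<le> z" "z \<le> 2 * (t * B)" for z
  proof -
    have "z powr p \<le> (2 * (t * B)) powr p" using that p by (intro powr_mono2) auto
    also have "\<dots> = 2 powr p * (t powr p * B powr p)" using AB t by (simp add: powr_mult)
    also have "\<dots> \<le> 2 powr p * (t\<^sup>2 * (A powr p + B powr p))"
    proof (intro mult_left_mono mult_mono)
      show "t powr p \<le> t\<^sup>2"
        using t p powr_mono'[of 2 p t] by (cases "t = 0") auto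
    qed auto
    finally show ?thesis by (simp add: mult.assoc)
  qed
  have "(A + t * B) powr p + \<bar>A - t * B\<bar> powr p \<le> 2 * (2 powr p * t\<^sup>2 * (A powr p + B powr p))"
  proof -
    have "0 \<le> t * B" using AB t by simp
    then have "(A + t * B) powr p \<le> 2 powr p * t\<^sup>2 * (A powr p + B powr p)"
      "\<bar>A - t * B\<bar> powr p \<le> 2 powr p * t\<^sup>2 * (A powr p + B powr p)"
      by - (rule *; use False AB in linarith)+
    then show ?thesis by linarith
  qed
  also have "\<dots> \<le> smooth_const p * t\<^sup>2 * (A powr p + B powr p)"
  proof -
    have "0 \<le> 2 * p * (p - 1) * (2 powr p * t\<^sup>2 * (A powr p + B powr p))"
      using p by (intro mult_nonneg_nonneg) auto
    then show ?thesis by (simp add: smooth_const_def algebra_simps)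
  qed
  finally show ?thesis by (smt (verit) powr_ge_zero)
qed

section \<open>Clarkson's inequality and smoothness in inner product spaces, covering real and
  complex scalars at once\<close>

lemma norm_powr_eq: "norm (v :: 'a::real_normed_vector) powr p = ((norm v)\<^sup>2) powr (p / 2)"
  by (cases "v = 0") (auto simp: powr_powr simp flip: powr_numeral)

text \<open>The squared norms of \<open>a + b\<close> and \<open>a - b\<close> are
  \<open>u + s\<close> and \<open>u - s\<close> with \<open>s = 2 * inner a b\<close>, so
  \<open>powr_even_mono\<close> with exponent \<open>p / 2\<close> applies. Comparing
  \<open>\<bar>s\<bar> = c\<close> with \<open>0\<close> gives the lower bound; comparing it with
  the Cauchy-Schwarz bound \<open>d\<close> gives the upper one.\<close>

lemma inner_powr_parallelogram:
  fixes a b :: "'a::real_inner"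
  assumes p: "2 \<le> p"
  shows "2 * (norm a powr p + norm b powr p) \<le> norm (a + b) powr p + norm (a - b) powr p" (is ?A)
    and "norm (a + b) powr p + norm (a - b) powr p
      \<le> (norm a + norm b) powr p + \<bar>norm a - norm b\<bar> powr p" (is ?B)
proof -
  define u c d where "u = (norm a)\<^sup>2 + (norm b)\<^sup>2" and "c = 2 * \<bar>inner a b\<bar>" and "d = 2 * (norm a * norm b)"
  have r: "1 \<le> p / 2" using p by simp
  have cd: "0 \<le> c" "c \<le> d" by (auto simp: c_def d_def Cauchy_Schwarz_ineq2)
  have "0 \<le> (norm a - norm b)\<^sup>2" by simp
  then have du: "d \<le> u" by (simp add: u_def d_def power2_diff)
  have e: "(norm (a + b))\<^sup>2 = u + 2 * inner a b" "(norm (a - b))\<^sup>2 = u - 2 * inner a b"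
    by (simp_all add: u_def power2_norm_eq_inner inner_add inner_diff inner_commute)
  have m: "norm (a + b) powr p + norm (a - b) powr p = (u + c) powr (p / 2) + (u - c) powr (p / 2)"
    unfolding norm_powr_eq e by (auto simp: c_def abs_if)
  have "norm a powr p + norm b powr p \<le> u powr (p / 2)"
    using powr_superadditive[OF r, of "(norm a)\<^sup>2" "(norm b)\<^sup>2"] unfolding norm_powr_eq u_def by simp
  moreover have "2 * u powr (p / 2) \<le> (u + c) powr (p / 2) + (u - c) powr (p / 2)"
    using powr_even_mono[OF r, of 0 c u] cd du by simp
  ultimately show ?A unfolding m by (simp only: distrib_left)
  have "(norm a + norm b) powr p = (u + d) powr (p / 2)"
    using norm_powr_eq[of "norm a + norm b" p] by (simp add: u_def d_def power2_sum algebra_simps)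
  moreover have "\<bar>norm a - norm b\<bar> powr p = (u - d) powr (p / 2)"
    using norm_powr_eq[of "norm a - norm b" p] by (simp add: u_def d_def power2_diff algebra_simps)
  ultimately show ?B using m powr_even_mono[OF r cd du] by simp
qed

lemma inner_powr_smooth:
  fixes a b :: "'a::real_inner"
  assumes "2 \<le> p" "0 \<le> t" "t \<le> 1"
  shows "norm (a + t *\<^sub>R b) powr p + norm (a - t *\<^sub>R b) powr p
    \<le> 2 * norm a powr p + smooth_const p * t\<^sup>2 * (norm a powr p + norm b powr p)"
  using inner_powr_parallelogram(2)[OF assms(1), of a "t *\<^sub>R b"]
    real_powr_smooth[of p "norm a" "norm b" t] assms by simp

section \<open>Subspaces of quotients of \<open>L\<^sub>p\<close>\<close>

abbreviation Lp_int :: "real \<Rightarrow> (real \<Rightarrow> 'k::real_normed_field) \<Rightarrow> real" where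
  "Lp_int p f \<equiv> LINT t|lebesgue_on {0..1}. norm (f t) powr p"

lemma module_Lp: "module (scl (Lp p))"
  by unfold_locales (auto simp: Lp_def fun_eq_iff algebra_simps)

lemma carr_Lp_iff: "f \<in> carr (Lp p) \<longleftrightarrow>
    f \<in> borel_measurable (lebesgue_on {0..1}) \<and> integrable (lebesgue_on {0..1}) (\<lambda>t. norm (f t) powr p)"
  by (simp add: Lp_def)

lemma carr_Lp_add:
  assumes "f \<in> carr (Lp p)" "g \<in> carr (Lp p)" "0 \<le> p"
  shows "f + g \<in> carr (Lp p)"
proof -
  have m: "f \<in> borel_measurable (lebesgue_on {0..1})" "g \<in> borel_measurable (lebesgue_on {0..1})"
    and i: "integrable (lebesgue_on {0..1}) (\<lambda>t. norm (f t) powr p)"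
      "integrable (lebesgue_on {0..1}) (\<lambda>t. norm (g t) powr p)"
    using assms by (auto simp: carr_Lp_iff)
  have mfg: "(\<lambda>t. f t + g t) \<in> borel_measurable (lebesgue_on {0..1})"
    using m by (rule borel_measurable_add)
  have "integrable (lebesgue_on {0..1}) (\<lambda>t. norm (f t + g t) powr p)"
  proof (rule Bochner_Integration.integrable_bound)
    show "integrable (lebesgue_on {0..1}) (\<lambda>t. 2 powr p * (norm (f t) powr p + norm (g t) powr p))"
      using i by simp
    show "(\<lambda>t. norm (f t + g t) powr p) \<in> borel_measurable (lebesgue_on {0..1})"
      using mfg by measurable
    show "AE t in lebesgue_on {0..1}. norm (norm (f t + g t) powr p)
        \<le> norm (2 powr p * (norm (f t) powr p + norm (g t) powr p))"
    proof (rule AE_I2)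
      fix t
      have "norm (f t + g t) powr p \<le> (norm (f t) + norm (g t)) powr p"
        using assms by (intro powr_mono2 norm_triangle_ineq) auto
      also have "\<dots> \<le> 2 powr p * (norm (f t) powr p + norm (g t) powr p)"
        using assms by (intro powr_add_le) auto
      finally show "norm (norm (f t + g t) powr p)
          \<le> norm (2 powr p * (norm (f t) powr p + norm (g t) powr p))"
        by simp
    qed
  qed
  then show ?thesis using mfg by (simp add: Lp_def plus_fun_def)
qed

section \<open>Transfer of the scalar inequalities to the space through representatives in
  \<open>Lp p\<close>\<close>

context
  fixes p :: real and Z :: "(real \<Rightarrow> 'k::{real_normed_field, euclidean_space}) set"
    and smul :: "'k \<Rightarrow> 'a::banach \<Rightarrow> 'a" and J :: "'a \<Rightarrow> (real \<Rightarrow> 'k) set"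
  assumes p: "2 \<le> p" and smul: "banach_over smul" and Z: "closed_subspace (Lp p) Z"
    and lin: "linear_map (type_space smul) (quotient_space (Lp p) Z) J"
    and iso: "\<And>x. nrm (quotient_space (Lp p) Z) (J x) = norm x"
begin

interpretation banach_over smul by (rule smul)

lemma subspace_Z: "module.subspace (scl (Lp p)) Z"
  using Z by (simp add: closed_subspace_def)

lemma coset_mem_carr: "f \<in> J x \<Longrightarrow> f \<in> carr (Lp p)"
proof -
  assume f: "f \<in> J x"
  have "J x \<in> carr (quotient_space (Lp p) Z)" using lin by (simp add: linear_map_def type_space_def)
  then obtain g where g: "g \<in> carr (Lp p)" "J x = g +o Z" by (auto simp: quotient_space_def)
  then obtain z where "z \<in> Z" "f = g + z" using f by (auto simp: elt_set_plus_def)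
  moreover have "z \<in> carr (Lp p)" using Z \<open>z \<in> Z\<close> by (auto simp: closed_subspace_def)
  ultimately show ?thesis using g carr_Lp_add[of g p z] p by simp
qed

lemma coset_nonempty: "J x \<noteq> {}"
proof -
  have "J x \<in> carr (quotient_space (Lp p) Z)" using lin by (simp add: linear_map_def type_space_def)
  then obtain g where "J x = g +o Z" by (auto simp: quotient_space_def)
  moreover have "0 \<in> Z" using module.subspace_0[OF module_Lp subspace_Z] .
  ultimately show ?thesis by (auto simp: elt_set_plus_def)
qed

lemma coset_add: "f \<in> J x \<Longrightarrow> g \<in> J y \<Longrightarrow> f + g \<in> J (x + y)"
proof -
  assume "f \<in> J x" "g \<in> J y"
  moreover have "J (x + y) = J x + J y" using lin by (simp add: linear_map_def type_space_def)
  ultimately show ?thesis by auto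
qed

lemma coset_scl: "f \<in> J x \<Longrightarrow> (\<lambda>s. t *\<^sub>R f s) \<in> J (t *\<^sub>R x)"
proof -
  assume "f \<in> J x"
  have "J (smul (of_real t) x) = scl (Lp p) (of_real t) ` J x + Z"
    using lin by (simp add: linear_map_def type_space_def quotient_space_def)
  \<comment> \<open>Choosing \<open>0\<close> in the extra summand \<open>Z\<close> of the scalar
    multiplication leaves the scaled representative itself.\<close>
  moreover have "0 \<in> Z" using module.subspace_0[OF module_Lp subspace_Z] .
  ultimately have "scl (Lp p) (of_real t) f + 0 \<in> J (smul (of_real t) x)"
    using \<open>f \<in> J x\<close> by (metis imageI set_plus_intro)
  then show ?thesis by (simp add: scale_of_real Lp_def scaleR_conv_of_real)
qed

lemma norm_eq_INF: "norm (x::'a) = (INF f\<in>J x. nrm (Lp p) f)"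
  using iso[of x] by (simp add: quotient_space_def)

lemma Lp_int_nonneg: "0 \<le> Lp_int p f"
  by (rule Bochner_Integration.integral_nonneg) simp

lemma norm_powr_le_Lp_int: "f \<in> J x \<Longrightarrow> norm x powr p \<le> Lp_int p f"
proof -
  assume f: "f \<in> J x"
  have "norm x \<le> nrm (Lp p) f"
    unfolding norm_eq_INF by (intro cINF_lower bdd_belowI2[of _ 0] f) (simp add: Lp_def)
  then have "norm x powr p \<le> nrm (Lp p) f powr p" using p by (intro powr_mono2) auto
  also have "\<dots> = Lp_int p f" using p Lp_int_nonneg[of f] by (simp add: Lp_def powr_powr)
  finally show ?thesis .
qed

text \<open>The quotient norm is an infimum over the coset, so almost optimal representatives exist;
  taking \<open>p\<close>-th powers preserves the strict inequality.\<close>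

lemma norm_powr_approx:
  assumes "norm x powr p < e"
  obtains f where "f \<in> J x" "Lp_int p f < e"
proof -
  have e: "0 < e" using assms by (smt (verit) powr_ge_zero)
  have "norm x = (norm x powr p) powr (1 / p)" using p by (simp add: powr_powr)
  also have "\<dots> < e powr (1 / p)" using assms p by (intro powr_less_mono2) auto
  finally have "(INF f\<in>J x. nrm (Lp p) f) < e powr (1 / p)" by (simp add: norm_eq_INF)
  then obtain f where f: "f \<in> J x" "nrm (Lp p) f < e powr (1 / p)"
    using cInf_lessD[of "nrm (Lp p) ` J x" "e powr (1 / p)"] coset_nonempty by auto
  have "Lp_int p f = nrm (Lp p) f powr p" using p Lp_int_nonneg[of f] by (simp add: Lp_def powr_powr)
  also have "\<dots> < (e powr (1 / p)) powr p" using f p by (intro powr_less_mono2) (auto simp: Lp_def)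
  also have "\<dots> = e" using p e by (simp add: powr_powr)
  finally show ?thesis using f that by blast
qed

lemma integrable_coset: "f \<in> J x \<Longrightarrow> integrable (lebesgue_on {0..1}) (\<lambda>t. norm (f t) powr p)"
  using coset_mem_carr by (auto simp: carr_Lp_iff)

lemma coset_combine:
  assumes "f \<in> J x" "g \<in> J y"
  shows "(\<lambda>s. f s + t *\<^sub>R g s) \<in> J (x + t *\<^sub>R y)"
  using coset_add[OF assms(1) coset_scl[OF assms(2), of t]] by (simp add: plus_fun_def)

text \<open>Almost optimal representatives \<open>u\<close>, \<open>v\<close> are taken for
  \<open>x + y\<close> and \<open>x - y\<close>, the vectors on the larger side. Their half sum and
  half difference represent \<open>x\<close> and \<open>y\<close>, and for these the norm is bounded
  by any representative.\<close>

lemma coset_clarkson: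
  fixes x y :: 'a
  shows "2 * (norm x powr p + norm y powr p) \<le> norm (x + y) powr p + norm (x - y) powr p"
proof (rule field_le_epsilon)
  fix e :: real assume "0 < e"
  obtain u where u: "u \<in> J (x + y)" "Lp_int p u < norm (x + y) powr p + e / 2"
    using norm_powr_approx[of "x + y" "norm (x + y) powr p + e / 2"] \<open>0 < e\<close> by auto
  obtain v where v: "v \<in> J (x - y)" "Lp_int p v < norm (x - y) powr p + e / 2"
    using norm_powr_approx[of "x - y" "norm (x - y) powr p + e / 2"] \<open>0 < e\<close> by auto
  define f where "f = (\<lambda>s. (1/2) *\<^sub>R (u s + 1 *\<^sub>R v s))"
  define g where "g = (\<lambda>s. (1/2) *\<^sub>R (u s + (-1) *\<^sub>R v s))"
  have "(1/2) *\<^sub>R (x + y + 1 *\<^sub>R (x - y)) = x" "(1/2) *\<^sub>R (x + y + (-1) *\<^sub>R (x - y)) = y"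
    by (simp_all flip: scaleR_2)
  then have fg: "f \<in> J x" "g \<in> J y"
    using coset_scl[OF coset_combine[OF u(1) v(1), of 1], of "1/2"]
      coset_scl[OF coset_combine[OF u(1) v(1), of "-1"], of "1/2"] by (simp_all add: f_def g_def)
  have "2 * (norm x powr p + norm y powr p) \<le> 2 * (Lp_int p f + Lp_int p g)"
    using norm_powr_le_Lp_int[OF fg(1)] norm_powr_le_Lp_int[OF fg(2)] by simp
  also have "\<dots> = (LINT t|lebesgue_on {0..1}. 2 * (norm (f t) powr p + norm (g t) powr p))"
    using integrable_coset[OF fg(1)] integrable_coset[OF fg(2)] by simp
  also have "\<dots> \<le> (LINT t|lebesgue_on {0..1}. norm (u t) powr p + norm (v t) powr p)"
  proof (rule integral_mono)
    fix t
    have "f t + g t = u t" "f t - g t = v t" by (simp_all add: f_def g_def algebra_simps flip: scaleR_add_left)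
    then show "2 * (norm (f t) powr p + norm (g t) powr p) \<le> norm (u t) powr p + norm (v t) powr p"
      using inner_powr_parallelogram(1)[OF p, of "f t" "g t"] by simp
  qed (use integrable_coset[OF fg(1)] integrable_coset[OF fg(2)] integrable_coset[OF u(1)]
      integrable_coset[OF v(1)] in auto)
  also have "\<dots> = Lp_int p u + Lp_int p v"
    using integrable_coset[OF u(1)] integrable_coset[OF v(1)] by simp
  finally show "2 * (norm x powr p + norm y powr p)
      \<le> norm (x + y) powr p + norm (x - y) powr p + e"
    using u v by simp
qed

text \<open>Here the larger side contains \<open>x\<close> and \<open>y\<close>, so these get the
  almost optimal representatives \<open>f\<close> and \<open>g\<close>; the combinations
  \<open>u\<close> and \<open>v\<close> are merely some representatives of the vectors on the
  smaller side.\<close>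

lemma coset_smooth:
  fixes x y :: 'a
  assumes t: "0 \<le> t" "t \<le> 1"
  shows "norm (x + t *\<^sub>R y) powr p + norm (x - t *\<^sub>R y) powr p
    \<le> 2 * norm x powr p + smooth_const p * t\<^sup>2 * (norm x powr p + norm y powr p)"
proof (rule field_le_epsilon)
  fix e :: real assume "0 < e"
  define D where "D = smooth_const p * t\<^sup>2"
  have D: "0 \<le> D" using p by (simp add: D_def smooth_const_nonneg)
  \<comment> \<open>The slack \<open>d\<close> enters with total weight
    \<open>2 + 2 * D\<close>.\<close>
  define d where "d = e / (2 + 2 * D)"
  have d: "0 < d" using D \<open>0 < e\<close> by (simp add: d_def)
  obtain f where f: "f \<in> J x" "Lp_int p f < norm x powr p + d"
    using norm_powr_approx[of x "norm x powr p + d"] d by auto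
  obtain g where g: "g \<in> J y" "Lp_int p g < norm y powr p + d"
    using norm_powr_approx[of y "norm y powr p + d"] d by auto
  define u where "u = (\<lambda>s. f s + t *\<^sub>R g s)"
  define v where "v = (\<lambda>s. f s + (-t) *\<^sub>R g s)"
  have uv: "u \<in> J (x + t *\<^sub>R y)" "v \<in> J (x - t *\<^sub>R y)"
    using coset_combine[OF f(1) g(1), of t] coset_combine[OF f(1) g(1), of "-t"]
    by (simp_all add: u_def v_def)
  note int = integrable_coset[OF f(1)] integrable_coset[OF g(1)]
    integrable_coset[OF uv(1)] integrable_coset[OF uv(2)]
  have "norm (x + t *\<^sub>R y) powr p + norm (x - t *\<^sub>R y) powr p \<le> Lp_int p u + Lp_int p v"
    using norm_powr_le_Lp_int[OF uv(1)] norm_powr_le_Lp_int[OF uv(2)] by simp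
  also have "\<dots> = (LINT t|lebesgue_on {0..1}. norm (u t) powr p + norm (v t) powr p)"
    using int by simp
  also have "\<dots> \<le> (LINT s|lebesgue_on {0..1}. 2 * norm (f s) powr p + D * (norm (f s) powr p + norm (g s) powr p))"
  proof (rule integral_mono)
    fix s
    show "norm (u s) powr p + norm (v s) powr p
        \<le> 2 * norm (f s) powr p + D * (norm (f s) powr p + norm (g s) powr p)"
      using inner_powr_smooth[OF p t, of "f s" "g s"] by (simp add: u_def v_def D_def)
  qed (use int in auto)
  also have "\<dots> = 2 * Lp_int p f + D * (Lp_int p f + Lp_int p g)"
    using int by simp
  also have "\<dots> \<le> 2 * (norm x powr p + d) + D * (norm x powr p + d + (norm y powr p + d))"
    using f g D by (intro add_mono mult_left_mono) auto
  also have "\<dots> = 2 * norm x powr p + D * (norm x powr p + norm y powr p) + d * (2 + 2 * D)"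
    by (simp add: algebra_simps)
  also have "d * (2 + 2 * D) = e" using D by (simp add: d_def)
  finally show "norm (x + t *\<^sub>R y) powr p + norm (x - t *\<^sub>R y) powr p
    \<le> 2 * norm x powr p + smooth_const p * t\<^sup>2 * (norm x powr p + norm y powr p) + e"
    by (simp add: D_def)
qed

end

lemma subspace_of_quotient_clarkson:
  fixes smul :: "'k::{real_normed_field, euclidean_space} \<Rightarrow> 'a::banach \<Rightarrow> 'a" and x y :: 'a
  assumes "2 \<le> p" "banach_over smul" "subspace_of_quotient_of_Lp p smul"
  shows "2 * (norm x powr p + norm y powr p) \<le> norm (x + y) powr p + norm (x - y) powr p"
proof -
  obtain Z J where "closed_subspace (Lp p) Z" "linear_map (type_space smul) (quotient_space (Lp p) Z) J"
    "\<And>x. nrm (quotient_space (Lp p) Z) (J x) = norm x"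
    using assms unfolding subspace_of_quotient_of_Lp_def by blast
  then show ?thesis using assms(1,2) by (intro coset_clarkson)
qed

text \<open>By Bernoulli's inequality \<open>norm z \<le> 1 + (norm z powr p - 1) / p\<close>.\<close>

lemma subspace_of_quotient_smooth:
  fixes smul :: "'k::{real_normed_field, euclidean_space} \<Rightarrow> 'a::banach \<Rightarrow> 'a" and x y :: 'a
  assumes p: "2 \<le> p" and "banach_over smul" "subspace_of_quotient_of_Lp p smul"
    and t: "0 \<le> t" "t \<le> 1" and xy: "norm x \<le> 1" "norm y \<le> 1"
  shows "norm (x + t *\<^sub>R y) + norm (x - t *\<^sub>R y) \<le> 2 + smooth_const p * t\<^sup>2"
proof -
  obtain Z J where "closed_subspace (Lp p) Z" "linear_map (type_space smul) (quotient_space (Lp p) Z) J"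
    "\<And>x. nrm (quotient_space (Lp p) Z) (J x) = norm x"
    using assms unfolding subspace_of_quotient_of_Lp_def by blast
  then have "norm (x + t *\<^sub>R y) powr p + norm (x - t *\<^sub>R y) powr p
      \<le> 2 * norm x powr p + smooth_const p * t\<^sup>2 * (norm x powr p + norm y powr p)"
    using assms(1,2) t by (intro coset_smooth)
  also have "\<dots> \<le> 2 * 1 + smooth_const p * t\<^sup>2 * (1 + 1)"
    using p xy by (intro add_mono mult_left_mono powr_le1) (auto simp: smooth_const_nonneg)
  finally have *: "norm (x + t *\<^sub>R y) powr p + norm (x - t *\<^sub>R y) powr p \<le> 2 + 2 * (smooth_const p * t\<^sup>2)"
    by simp
  have "p * norm z \<le> norm z powr p + p - 1" for z :: 'a
    using powr_tangent[of p "norm z" 1] p by (simp add: algebra_simps)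
  from this[of "x + t *\<^sub>R y"] this[of "x - t *\<^sub>R y"] *
  have "p * (norm (x + t *\<^sub>R y) + norm (x - t *\<^sub>R y)) \<le> 2 * p + 2 * (smooth_const p * t\<^sup>2)"
    by (simp add: distrib_left)
  also have "\<dots> \<le> p * (2 + smooth_const p * t\<^sup>2)"
  proof -
    \<comment> \<open>The bound \<open>p \<ge> 2\<close> absorbs the factor \<open>2\<close>, so the
      same constant survives the division by \<open>p\<close>.\<close>
    have "2 * (smooth_const p * t\<^sup>2) \<le> p * (smooth_const p * t\<^sup>2)"
      using p by (intro mult_right_mono) (auto simp: smooth_const_nonneg)
    then show ?thesis by (simp add: distrib_left)
  qed
  finally show ?thesis using p by simp
qed

section \<open>Spaces of operators\<close>

lemma type_space_simps [simp]:
  "carr (type_space smul) = UNIV" "scl (type_space smul) = smul" "nrm (type_space smul) = norm"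
  by (simp_all add: type_space_def)

text \<open>The scalar multiplication is total and satisfies the vector space laws on the whole
  ambient type; the seminorm laws are required on the carrier only, as for sequences whose series
  converges.\<close>

locale normed_nspace =
  fixes E :: "('k::real_normed_field, 'v::ab_group_add) nspace"
  assumes vector_space_scl: "vector_space (scl E)"
    and subspace_carr: "module.subspace (scl E) (carr E)"
    and nrm_triangle: "x \<in> carr E \<Longrightarrow> y \<in> carr E \<Longrightarrow> nrm E (x + y) \<le> nrm E x + nrm E y"
    and nrm_scl: "x \<in> carr E \<Longrightarrow> nrm E (scl E c x) = norm c * nrm E x"
begin

sublocale vector_space "scl E"
  by (rule vector_space_scl)

lemma carr_zero [simp]: "0 \<in> carr E"
  and carr_add [intro]: "x \<in> carr E \<Longrightarrow> y \<in> carr E \<Longrightarrow> x + y \<in> carr E"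
  and carr_scl [intro]: "x \<in> carr E \<Longrightarrow> scl E c x \<in> carr E"
  and carr_diff [intro]: "x \<in> carr E \<Longrightarrow> y \<in> carr E \<Longrightarrow> x - y \<in> carr E"
  using subspace_carr by (auto simp: subspace_0 subspace_add subspace_scale subspace_diff)

lemma nrm_zero [simp]: "nrm E 0 = 0"
  using nrm_scl[of 0 0] by simp

lemma nrm_minus: "x \<in> carr E \<Longrightarrow> nrm E (- x) = nrm E x"
  using nrm_scl[of x "-1"] by simp

lemma nrm_nonneg: "x \<in> carr E \<Longrightarrow> 0 \<le> nrm E x"
  using nrm_triangle[of x "- x"] carr_diff[of 0 x] nrm_minus[of x] by simp

lemma nrm_minus_commute: "x \<in> carr E \<Longrightarrow> y \<in> carr E \<Longrightarrow> nrm E (x - y) = nrm E (y - x)"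
  using nrm_minus[of "x - y"] carr_diff by auto

lemma nrm_triangle_diff: "x \<in> carr E \<Longrightarrow> y \<in> carr E \<Longrightarrow> nrm E (x - y) \<le> nrm E x + nrm E y"
  using nrm_triangle[of x "- y"] carr_diff[of 0 y] nrm_minus[of y] by simp

end

locale nspace_pair = dom: normed_nspace E + cod: normed_nspace F
  for E :: "('k::real_normed_field, 'v::ab_group_add) nspace"
    and F :: "('k, 'w::ab_group_add) nspace"
begin

lemma op_mem: "T \<in> carr (op_space E F) \<Longrightarrow> x \<in> carr E \<Longrightarrow> T x \<in> carr F"
  and op_add: "T \<in> carr (op_space E F) \<Longrightarrow> x \<in> carr E \<Longrightarrow> y \<in> carr E \<Longrightarrow> T (x + y) = T x + T y"
  and op_scl: "T \<in> carr (op_space E F) \<Longrightarrow> x \<in> carr E \<Longrightarrow> T (scl E c x) = scl F c (T x)"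
  and op_outside: "T \<in> carr (op_space E F) \<Longrightarrow> x \<notin> carr E \<Longrightarrow> T x = 0"
  by (auto simp: op_space_def linear_map_def)

lemma op_diff:
  assumes "T \<in> carr (op_space E F)" "x \<in> carr E" "y \<in> carr E"
  shows "T (x - y) = T x - T y"
  using op_add[OF assms(1) dom.carr_diff[OF assms(2,3)] assms(3)] by simp

lemma op_zero: "T \<in> carr (op_space E F) \<Longrightarrow> T 0 = 0"
  using op_diff[of T 0 0] by simp

lemma op_norm_le:
  assumes "\<And>x. x \<in> carr E \<Longrightarrow> nrm E x \<le> 1 \<Longrightarrow> nrm F (T x) \<le> C"
  shows "op_norm E F T \<le> C"
  unfolding op_norm_def
proof (rule cSUP_least)
  have "0 \<in> {x \<in> carr E. nrm E x \<le> 1}" by simp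
  then show "{x \<in> carr E. nrm E x \<le> 1} \<noteq> {}" by blast
qed (use assms in auto)

lemma op_bounded:
  assumes "T \<in> carr (op_space E F)"
  obtains C where "0 \<le> C" "\<And>x. x \<in> carr E \<Longrightarrow> nrm F (T x) \<le> C * nrm E x"
proof -
  obtain C where C: "\<And>x. x \<in> carr E \<Longrightarrow> nrm F (T x) \<le> C * nrm E x"
    using assms by (auto simp: op_space_def)
  have "nrm F (T x) \<le> max 0 C * nrm E x" if "x \<in> carr E" for x
    using C[OF that] mult_right_mono[of C "max 0 C" "nrm E x"] dom.nrm_nonneg[OF that] by linarith
  then show ?thesis using that[of "max 0 C"] by simp
qed

lemma nrm_le_op_norm:
  assumes T: "T \<in> carr (op_space E F)" and x: "x \<in> carr E" "nrm E x \<le> 1"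
  shows "nrm F (T x) \<le> op_norm E F T"
  unfolding op_norm_def
proof (rule cSUP_upper)
  obtain C where C: "0 \<le> C" "\<And>x. x \<in> carr E \<Longrightarrow> nrm F (T x) \<le> C * nrm E x"
    using op_bounded[OF T] by blast
  have "nrm F (T x) \<le> C" if "x \<in> carr E" "nrm E x \<le> 1" for x
    using C(2)[OF that(1)] mult_left_mono[OF that(2) C(1)] by linarith
  then show "bdd_above ((\<lambda>x. nrm F (T x)) ` {x \<in> carr E. nrm E x \<le> 1})"
    by (intro bdd_aboveI2[of _ _ C]) auto
qed (use x in auto)

lemma op_norm_nonneg: "T \<in> carr (op_space E F) \<Longrightarrow> 0 \<le> op_norm E F T"
  using nrm_le_op_norm[of T 0] op_zero[of T] by simp

lemma op_norm_bound:
  assumes T: "T \<in> carr (op_space E F)" and x: "x \<in> carr E"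
  shows "nrm F (T x) \<le> op_norm E F T * nrm E x"
proof (cases "nrm E x = 0")
  \<comment> \<open>The norm of \<open>E\<close> is only a seminorm here, so \<open>x\<close> may be
    nonzero; boundedness of \<open>T\<close> still gives \<open>T x\<close> norm zero.\<close>
  case True
  obtain C where C: "0 \<le> C" "\<And>x. x \<in> carr E \<Longrightarrow> nrm F (T x) \<le> C * nrm E x"
    using op_bounded[OF T] by blast
  show ?thesis using C(2)[OF x] True by simp
next
  case False
  then have pos: "0 < nrm E x" using dom.nrm_nonneg[OF x] by simp
  define c :: 'k where "c = of_real (1 / nrm E x)"
  have c: "norm c = 1 / nrm E x" using pos by (simp add: c_def norm_divide)
  have "nrm F (T (scl E c x)) \<le> op_norm E F T"
    using x pos c by (intro nrm_le_op_norm[OF T]) (auto simp: dom.nrm_scl)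
  then have "(1 / nrm E x) * nrm F (T x) \<le> op_norm E F T"
    using op_scl[OF T x] cod.nrm_scl[OF op_mem[OF T x]] c by simp
  then show ?thesis using pos by (simp add: field_simps)
qed

lemma op_spaceI:
  assumes "\<And>x. x \<in> carr E \<Longrightarrow> T x \<in> carr F"
    and "\<And>x y. x \<in> carr E \<Longrightarrow> y \<in> carr E \<Longrightarrow> T (x + y) = T x + T y"
    and "\<And>c x. x \<in> carr E \<Longrightarrow> T (scl E c x) = scl F c (T x)"
    and "\<And>x. x \<notin> carr E \<Longrightarrow> T x = 0"
    and "\<And>x. x \<in> carr E \<Longrightarrow> nrm F (T x) \<le> C * nrm E x"
  shows "T \<in> carr (op_space E F)"
proof -
  have "\<exists>C. \<forall>x\<in>carr E. nrm F (T x) \<le> C * nrm E x" using assms(5) by blast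
  then show ?thesis using assms(1-4) by (simp add: op_space_def linear_map_def)
qed

lemma scl_op_space [simp]: "scl (op_space E F) c T = (\<lambda>x. scl F c (T x))"
  and nrm_op_space [simp]: "nrm (op_space E F) = op_norm E F"
  by (auto simp: op_space_def)

lemma op_norm_scl_le:
  assumes "T \<in> carr (op_space E F)"
  shows "op_norm E F (\<lambda>x. scl F c (T x)) \<le> norm c * op_norm E F T"
  using assms by (intro op_norm_le) (auto simp: cod.nrm_scl op_mem intro!: mult_left_mono nrm_le_op_norm)

lemma normed_nspace_op_space: "normed_nspace (op_space E F)"
proof
  have m: "vector_space (scl (op_space E F))"
    by unfold_locales (auto simp: fun_eq_iff cod.scale_right_distrib cod.scale_left_distrib)
  interpret vs: vector_space "scl (op_space E F)" by (rule m)
  show "scl (op_space E F) a (x + y) = scl (op_space E F) a x + scl (op_space E F) a y"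
    "scl (op_space E F) (a + b) x = scl (op_space E F) a x + scl (op_space E F) b x"
    "scl (op_space E F) a (scl (op_space E F) b x) = scl (op_space E F) (a * b) x"
    "scl (op_space E F) 1 x = x" for a b x y
    by (auto simp: fun_eq_iff cod.scale_right_distrib cod.scale_left_distrib)
  have scl_mem: "scl (op_space E F) c T \<in> carr (op_space E F)" if T: "T \<in> carr (op_space E F)" for c T
  proof (rule op_spaceI)
    fix x assume x: "x \<in> carr E"
    show "scl (op_space E F) c T x \<in> carr F" using op_mem[OF T x] by auto
    show "scl (op_space E F) c T (scl E d x) = scl F d (scl (op_space E F) c T x)" for d
      using op_scl[OF T x] by (simp add: mult.commute)
    show "nrm F (scl (op_space E F) c T x) \<le> (norm c * op_norm E F T) * nrm E x"
      using op_norm_bound[OF T x] op_mem[OF T x] by (auto simp: cod.nrm_scl mult.assoc intro!: mult_left_mono)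
  qed (auto simp: op_add[OF T] op_outside[OF T] cod.scale_right_distrib)
  show "vs.subspace (carr (op_space E F))"
  proof (rule vs.subspaceI)
    show "0 \<in> carr (op_space E F)" by (rule op_spaceI[where C = 0]) auto
    show "T + S \<in> carr (op_space E F)" if T: "T \<in> carr (op_space E F)" and S: "S \<in> carr (op_space E F)" for T S
    proof (rule op_spaceI)
      fix x assume x: "x \<in> carr E"
      show "(T + S) x \<in> carr F" using op_mem[OF T x] op_mem[OF S x] by auto
      show "nrm F ((T + S) x) \<le> (op_norm E F T + op_norm E F S) * nrm E x"
        using op_norm_bound[OF T x] op_norm_bound[OF S x] cod.nrm_triangle[OF op_mem[OF T x] op_mem[OF S x]]
        by (simp add: distrib_right)
    qed (auto simp: op_add[OF T] op_add[OF S] op_scl[OF T] op_scl[OF S] op_outside[OF T] op_outside[OF S]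
        cod.scale_right_distrib)
  qed (rule scl_mem)
  show "nrm (op_space E F) (T + S) \<le> nrm (op_space E F) T + nrm (op_space E F) S"
    if T: "T \<in> carr (op_space E F)" and S: "S \<in> carr (op_space E F)" for T S
    unfolding nrm_op_space
  proof (rule op_norm_le)
    fix x assume x: "x \<in> carr E" "nrm E x \<le> 1"
    show "nrm F ((T + S) x) \<le> op_norm E F T + op_norm E F S"
      using nrm_le_op_norm[OF T x] nrm_le_op_norm[OF S x]
        cod.nrm_triangle[OF op_mem[OF T x(1)] op_mem[OF S x(1)]] by simp
  qed
  show "nrm (op_space E F) (scl (op_space E F) c T) = norm c * nrm (op_space E F) T"
    if T: "T \<in> carr (op_space E F)" for c T
  proof (cases "c = 0")
    case True
    have "op_norm E F (\<lambda>x. 0) \<le> 0" by (rule op_norm_le) simp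
    moreover have "0 \<le> op_norm E F (\<lambda>x. 0)"
      using op_norm_nonneg[OF scl_mem[OF T, of 0]] by simp
    ultimately show ?thesis using True by simp
  next
    case False
    \<comment> \<open>The reverse inequality is the easy one applied to the scaled operator and the
      inverse scalar.\<close>
    have "op_norm E F T \<le> norm (inverse c) * op_norm E F (\<lambda>x. scl F c (T x))"
      using op_norm_scl_le[OF scl_mem[OF T, of c], of "inverse c"] False by simp
    then have "norm c * op_norm E F T \<le> op_norm E F (\<lambda>x. scl F c (T x))"
      using False by (simp add: norm_inverse norm_divide field_simps)
    then show ?thesis using op_norm_scl_le[OF T, of c] by simp
  qed
qed

end

lemma normed_nspace_field: "normed_nspace (type_space ((*) :: 'k::real_normed_field \<Rightarrow> 'k \<Rightarrow> 'k))"
proof -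
  have vs: "vector_space ((*) :: 'k \<Rightarrow> 'k \<Rightarrow> 'k)"
    by unfold_locales (auto simp: algebra_simps)
  then have "module ((*) :: 'k \<Rightarrow> 'k \<Rightarrow> 'k)" by (simp add: module_iff_vector_space)
  with vs show ?thesis
    by (auto simp: normed_nspace_def type_space_def module.subspace_UNIV norm_triangle_ineq norm_mult)
qed

text \<open>Rotate \<open>w\<close> into the direction of \<open>z\<close>. This turns a sum of two
  absolute values into the absolute value of a single value of a functional.\<close>

lemma exists_unimodular_aligned:
  fixes z w :: "'k::real_normed_field"
  obtains a where "norm a = 1" "norm (z + a * w) = norm z + norm w"
proof (cases "z = 0 \<or> w = 0")
  case True
  then show ?thesis using that[of 1] by auto
next
  case False
  define a where "a = (z / of_real (norm z)) * (of_real (norm w) / w)"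
  have "norm a = 1" using False by (simp add: a_def norm_mult norm_divide)
  moreover have "z + a * w = (z / of_real (norm z)) * of_real (norm z + norm w)"
    using False by (simp add: a_def field_simps)
  then have "norm (z + a * w) = norm (z / of_real (norm z)) * norm (of_real (norm z + norm w) :: 'k)"
    by (simp only: norm_mult)
  then have "norm (z + a * w) = norm z + norm w"
    using False by (simp add: norm_divide del: of_real_add)
  ultimately show ?thesis by (rule that)
qed

section \<open>A criterion for M-ideals\<close>

lemma le_if_le_mult_one_plus:
  fixes x y :: real
  assumes "\<And>e. 0 < e \<Longrightarrow> x \<le> y * (1 + e)"
  shows "x \<le> y"
proof -
  have "((\<lambda>e. y * (1 + e)) \<longlongrightarrow> y * (1 + 0)) (at_right 0)"
    by (intro tendsto_intros)
  moreover have "eventually (\<lambda>e. x \<le> y * (1 + e)) (at_right 0)"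
    using assms by (auto simp: eventually_at_right_field intro: exI[of _ 1])
  ultimately have "x \<le> y * (1 + 0)"
    by (rule tendsto_lowerbound) simp
  then show ?thesis by simp
qed

text \<open>
  The complement of the annihilator of \<open>J\<close> consists of the functionals \<open>v\<close> with \<open>v (R n T) \<longlonglongrightarrow> v T\<close> for all
  \<open>T\<close>, and the component of \<open>\<phi>\<close> in it is \<open>T \<mapsto> lim \<phi> (R n T)\<close>.  The limit exists: if \<open>N\<close> is the norm of
  \<open>\<phi>\<close> on \<open>J\<close> and \<open>S \<in> J\<close> almost attains it, then \<open>R m (T - R n T + a S)\<close> is an element of \<open>J\<close> of norm
  almost \<open>1\<close>, so that \<open>\<bar>\<phi> (R m T) - \<phi> (R n T)\<bar> + \<bar>\<phi> S\<bar>\<close> is at most about \<open>N\<close> for \<open>m \<gg> n \<gg> 1\<close>.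
\<close>

theorem M_ideal_criterion:
  fixes E :: "('k::{real_normed_field, banach}, 'v::ab_group_add) nspace"
    and R :: "nat \<Rightarrow> 'v \<Rightarrow> 'v" and c :: "nat \<Rightarrow> real"
  assumes E: "normed_nspace E" and J: "closed_subspace E J"
    and R_mem: "\<And>n T. T \<in> carr E \<Longrightarrow> R n T \<in> J"
    and R_add: "\<And>n S T. S \<in> carr E \<Longrightarrow> T \<in> carr E \<Longrightarrow> R n (S + T) = R n S + R n T"
    and R_scl: "\<And>n a T. T \<in> carr E \<Longrightarrow> R n (scl E a T) = scl E a (R n T)"
    and R_norm: "\<And>n T. T \<in> carr E \<Longrightarrow> nrm E (R n T) \<le> c n * nrm E T"
    and c: "c \<longlonglongrightarrow> 1"
    and R_conv: "\<And>S. S \<in> J \<Longrightarrow> (\<lambda>n. nrm E (S - R n S)) \<longlonglongrightarrow> 0"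
    and R_est: "\<And>S T e. T \<in> carr E \<Longrightarrow> S \<in> J \<Longrightarrow> nrm E T \<le> 1 \<Longrightarrow> nrm E S \<le> 1 \<Longrightarrow> 0 < e \<Longrightarrow>
      eventually (\<lambda>n. \<forall>a. norm a = 1 \<longrightarrow> nrm E (T - R n T + scl E a S) \<le> 1 + e) sequentially"
  shows "M_ideal E J"
proof -
  interpret E: normed_nspace E by (rule E)
  interpret P: nspace_pair E "type_space ((*) :: 'k \<Rightarrow> 'k \<Rightarrow> 'k)"
    by (simp add: nspace_pair_def E normed_nspace_field)
  interpret D: normed_nspace "dual E"
    unfolding dual_def by (rule P.normed_nspace_op_space)
  have J_sub: "J \<subseteq> carr E" and J_sp: "E.subspace J"
    using J by (auto simp: closed_subspace_def)
  have R_carr: "R n T \<in> carr E" if "T \<in> carr E" for n T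
    using R_mem[OF that] J_sub by auto
  have d_add: "u (S + T) = u S + u T" if "u \<in> carr (dual E)" "S \<in> carr E" "T \<in> carr E" for u S T
    using P.op_add that by (simp add: dual_def)
  have d_diff: "u (S - T) = u S - u T" if "u \<in> carr (dual E)" "S \<in> carr E" "T \<in> carr E" for u S T
    using P.op_diff that by (simp add: dual_def)
  have d_scl: "u (scl E a T) = a * u T" if "u \<in> carr (dual E)" "T \<in> carr E" for u a T
    using P.op_scl that by (simp add: dual_def type_space_simps)
  have d_bound: "norm (u T) \<le> nrm (dual E) u * nrm E T" if "u \<in> carr (dual E)" "T \<in> carr E" for u T
    using P.op_norm_bound that by (simp add: dual_def type_space_simps)
  have d_le: "nrm (dual E) u \<le> C" if "\<And>T. T \<in> carr E \<Longrightarrow> nrm E T \<le> 1 \<Longrightarrow> norm (u T) \<le> C" for u C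
    using P.op_norm_le[of u C] that by (simp add: dual_def type_space_simps)
  have dI: "u \<in> carr (dual E)"
    if "\<And>S T. S \<in> carr E \<Longrightarrow> T \<in> carr E \<Longrightarrow> u (S + T) = u S + u T"
      "\<And>a T. T \<in> carr E \<Longrightarrow> u (scl E a T) = a * u T" "\<And>T. T \<notin> carr E \<Longrightarrow> u T = 0"
      "\<And>T. T \<in> carr E \<Longrightarrow> norm (u T) \<le> C * nrm E T" for u C
    unfolding dual_def by (rule P.op_spaceI[where C = C]) (use that in \<open>auto simp: type_space_simps\<close>)
  have d_out: "u T = 0" if "u \<in> carr (dual E)" "T \<notin> carr E" for u T
    using P.op_outside that by (simp add: dual_def)
  have d_lim: "(\<lambda>n. u (f n)) \<longlonglongrightarrow> u x"
    if u: "u \<in> carr (dual E)" and f: "\<And>n. f n \<in> carr E" "x \<in> carr E"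
      and l: "(\<lambda>n. nrm E (x - f n)) \<longlonglongrightarrow> 0" for u f x
  proof -
    have "(\<lambda>n. u (f n) - u x) \<longlonglongrightarrow> 0"
    proof (rule Lim_null_comparison)
      have "norm (u (f n) - u x) \<le> nrm (dual E) u * nrm E (x - f n)" for n
        using d_bound[OF u E.carr_diff[OF f(1)[of n] f(2)]] d_diff[OF u f(1)[of n] f(2)]
        by (simp add: E.nrm_minus_commute f)
      then show "\<forall>\<^sub>F n in sequentially. norm (u (f n) - u x) \<le> nrm (dual E) u * nrm E (x - f n)"
        by simp
      show "(\<lambda>n. nrm (dual E) u * nrm E (x - f n)) \<longlonglongrightarrow> 0"
        using tendsto_mult_left[OF l, of "nrm (dual E) u"] by simp
    qed
    then show ?thesis by (simp add: LIM_zero_iff)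
  qed
  obtain B where B: "0 < B" "\<And>n. c n \<le> B"
    using convergent_imp_Bseq[of c] c by (auto simp: convergent_def Bseq_def) (meson abs_le_D1)
  have R_B: "nrm E (R n T) \<le> B * nrm E T" if "T \<in> carr E" for n T
    using R_norm[OF that, of n] mult_right_mono[OF B(2)[of n] E.nrm_nonneg[OF that]] by linarith
  have scl_lim: "(\<lambda>n. u (R n S)) \<longlonglongrightarrow> u S" if "u \<in> carr (dual E)" "S \<in> J" for u S
    using that J_sub R_carr R_conv by (intro d_lim) auto

  define V where "V = {v \<in> carr (dual E). \<forall>T\<in>carr E. (\<lambda>n. v (T - R n T)) \<longlonglongrightarrow> 0}"
  have V_closed: "closed_subspace (dual E) V"
    unfolding closed_subspace_def
  proof (intro conjI allI impI)
    show "V \<subseteq> carr (dual E)" by (auto simp: V_def)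
    show "D.subspace V"
    proof (rule D.subspaceI)
      show "0 \<in> V" by (auto simp: V_def)
      show "u + v \<in> V" if "u \<in> V" "v \<in> V" for u v
        using that by (auto simp: V_def intro: tendsto_add_zero)
      show "scl (dual E) a v \<in> V" if "v \<in> V" for a v
        using that D.carr_scl[of v a]
        by (auto simp: V_def dual_def type_space_simps intro: tendsto_mult_right_zero)
    qed
    fix z :: "nat \<Rightarrow> 'v \<Rightarrow> 'k" and v
    assume *: "(\<forall>n. z n \<in> V) \<and> v \<in> carr (dual E) \<and> (\<lambda>n. nrm (dual E) (z n - v)) \<longlonglongrightarrow> 0"
    show "v \<in> V"
      unfolding V_def
    proof (intro CollectI conjI ballI)
      show v: "v \<in> carr (dual E)" using * by simp
      fix T assume T: "T \<in> carr E"
      define C where "C = (1 + B) * nrm E T"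
      have C: "0 \<le> C" using E.nrm_nonneg[OF T] B by (simp add: C_def)
      have TR: "T - R n T \<in> carr E" for n using T R_carr[OF T] by auto
      have nTR: "nrm E (T - R n T) \<le> C" for n
        using E.nrm_triangle_diff[OF T R_carr[OF T, of n]] R_B[OF T, of n] by (simp add: C_def distrib_right)
      show "(\<lambda>n. v (T - R n T)) \<longlonglongrightarrow> 0"
      proof (rule LIMSEQ_I)
        fix r :: real assume r: "0 < r"
        \<comment> \<open>The vectors \<open>T - R n T\<close> are bounded by \<open>C\<close>
          uniformly in \<open>n\<close>, so one \<open>z j\<close> close to \<open>v\<close>
          controls all of them; \<open>C + 1\<close> keeps the denominator positive.\<close>
        have "eventually (\<lambda>j. nrm (dual E) (z j - v) < r / (2 * (C + 1))) sequentially"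
          using * r C by (intro order_tendstoD(2)[where y = 0]) auto
        then obtain j where j: "nrm (dual E) (z j - v) < r / (2 * (C + 1))"
          by (meson eventually_sequentially order_refl)
        have zj: "z j \<in> carr (dual E)" "(\<lambda>n. z j (T - R n T)) \<longlonglongrightarrow> 0"
          using * T by (auto simp: V_def)
        from zj(2) r obtain n0 where n0: "\<And>n. n \<ge> n0 \<Longrightarrow> norm (z j (T - R n T)) < r / 2"
          using LIMSEQ_D[of "\<lambda>n. z j (T - R n T)" 0 "r / 2"] by auto
        have "norm (v (T - R n T) - 0) < r" if "n \<ge> n0" for n
        proof -
          have "norm ((z j - v) (T - R n T)) \<le> nrm (dual E) (z j - v) * nrm E (T - R n T)"
            by (intro d_bound D.carr_diff zj(1) v TR)
          also have "\<dots> \<le> r / (2 * (C + 1)) * (C + 1)"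
            using j nTR[of n] E.nrm_nonneg[OF TR[of n]] r C by (intro mult_mono) auto
          also have "\<dots> = r / 2" using C by (simp add: divide_simps)
          finally have "norm (z j (T - R n T) - v (T - R n T)) \<le> r / 2" by simp
          then show ?thesis
            using n0[OF that] norm_triangle_sub[of "v (T - R n T)" "z j (T - R n T)"]
            by (simp add: norm_minus_commute)
        qed
        then show "\<exists>n0. \<forall>n\<ge>n0. norm (v (T - R n T) - 0) < r" by blast
      qed
    qed
  qed

  have annD: "u \<in> carr (dual E)" "\<And>S. S \<in> J \<Longrightarrow> u S = 0" if "u \<in> annihilator E J" for u
    using that by (auto simp: annihilator_def)

  \<comment> \<open>On \<open>T - R n T + a S'\<close> with \<open>S'\<close> in \<open>J\<close>,
    the functional \<open>u\<close> sees only \<open>T\<close>, while \<open>v\<close> sees only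
    \<open>a S'\<close> in the limit. By \<open>R_est\<close> such vectors have norm at most
    \<open>1 + e\<close>, and a suitable \<open>a\<close> aligns the two values.\<close>
  have additive_aux: "norm (u T) + norm (v S) \<le> nrm (dual E) (u + v)"
    if u: "u \<in> annihilator E J" and v: "v \<in> V"
      and T: "T \<in> carr E" "nrm E T \<le> 1" and S: "S \<in> carr E" "nrm E S \<le> 1" for u v S T
  proof -
    have v': "v \<in> carr (dual E)" and vlim: "\<And>T. T \<in> carr E \<Longrightarrow> (\<lambda>n. v (T - R n T)) \<longlonglongrightarrow> 0"
      using v by (auto simp: V_def)
    have uv: "u + v \<in> carr (dual E)" using annD[OF u] v' by auto
    define d where "d m = max 1 (c m)" for m
    have d: "1 \<le> d m" "c m \<le> d m" for m by (auto simp: d_def)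
    have d1: "d \<longlonglongrightarrow> 1" unfolding d_def using tendsto_max[OF tendsto_const c, of 1] by simp
    \<comment> \<open>\<open>S\<close> need not lie in \<open>J\<close>, so it is replaced by
      \<open>R m S\<close>. Dividing by \<open>d m\<close>, which is at least \<open>c m\<close>,
      puts it into the unit ball; as \<open>d m\<close> tends to \<open>1\<close>,
      \<open>v (S' m)\<close> still tends to \<open>v S\<close>.\<close>
    define S' where "S' m = scl E (of_real (1 / d m)) (R m S)" for m
    have S'J: "S' m \<in> J" for m using E.subspace_scale[OF J_sp R_mem[OF S(1)]] by (simp add: S'_def)
    have S'n: "nrm E (S' m) \<le> 1" for m
    proof -
      have "nrm E (R m S) \<le> c m * nrm E S" by (rule R_norm[OF S(1)])
      also have "\<dots> \<le> d m * 1"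
        using d[of m] S E.nrm_nonneg[OF S(1)] by (intro mult_mono) auto
      finally show ?thesis
        using d(1)[of m] E.nrm_scl[OF R_carr[OF S(1)]] by (simp add: S'_def norm_divide)
    qed
    have step: "norm (u T) + norm (v (S' m)) \<le> nrm (dual E) (u + v)" for m
    proof (rule le_if_le_mult_one_plus)
      fix e :: real assume e: "0 < e"
      have S'c: "S' m \<in> carr E" using S'J[of m] J_sub by blast
      obtain a where a: "norm a = 1" "norm (u T + a * v (S' m)) = norm (u T) + norm (v (S' m))"
        using exists_unimodular_aligned .
      have val: "(u + v) (T - R n T + scl E a (S' m)) = u T + v (T - R n T) + a * v (S' m)" for n
        using d_add[OF uv E.carr_diff[OF T(1) R_carr[OF T(1)]] E.carr_scl[OF S'c]]
          d_scl[OF uv S'c] d_diff[OF annD(1)[OF u] T(1) R_carr[OF T(1)]]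
          annD(2)[OF u R_mem[OF T(1)]] annD(2)[OF u S'J]
        by simp
      have "(\<lambda>n. norm (u T + v (T - R n T) + a * v (S' m))) \<longlonglongrightarrow> norm (u T + 0 + a * v (S' m))"
        by (intro tendsto_intros vlim T(1))
      moreover have "eventually (\<lambda>n. norm (u T + v (T - R n T) + a * v (S' m))
          \<le> nrm (dual E) (u + v) * (1 + e)) sequentially"
        using R_est[OF T(1) S'J[of m] T(2) S'n[of m] e]
      proof eventually_elim
        case (elim n)
        have "norm ((u + v) (T - R n T + scl E a (S' m)))
            \<le> nrm (dual E) (u + v) * nrm E (T - R n T + scl E a (S' m))"
          using T R_carr S'c by (intro d_bound uv) auto
        also have "\<dots> \<le> nrm (dual E) (u + v) * (1 + e)"
          using elim a D.nrm_nonneg[OF uv] by (intro mult_left_mono) auto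
        finally show ?case by (simp only: val)
      qed
      ultimately have "norm (u T + 0 + a * v (S' m)) \<le> nrm (dual E) (u + v) * (1 + e)"
        by (intro tendsto_upperbound) auto
      then show "norm (u T) + norm (v (S' m)) \<le> nrm (dual E) (u + v) * (1 + e)" using a by simp
    qed
    have "(\<lambda>m. v (S - R m S)) \<longlonglongrightarrow> 0" by (rule vlim[OF S(1)])
    then have "(\<lambda>m. v S - v (S - R m S)) \<longlonglongrightarrow> v S - 0" by (intro tendsto_diff tendsto_const)
    then have "(\<lambda>m. v (R m S)) \<longlonglongrightarrow> v S"
      using d_diff[OF v' S(1) R_carr[OF S(1)]] by simp
    then have "(\<lambda>m. of_real (1 / d m) * v (R m S)) \<longlonglongrightarrow> of_real (1 / 1) * v S"
      by (intro tendsto_intros d1) auto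
    then have "(\<lambda>m. v (S' m)) \<longlonglongrightarrow> v S"
      using d_scl[OF v' R_carr[OF S(1)]] by (simp add: S'_def)
    then have "(\<lambda>m. norm (u T) + norm (v (S' m))) \<longlonglongrightarrow> norm (u T) + norm (v S)"
      by (intro tendsto_intros)
    then show ?thesis
      by (rule tendsto_upperbound) (simp_all add: step)
  qed
  have additive: "nrm (dual E) (u + v) = nrm (dual E) u + nrm (dual E) v"
    if u: "u \<in> annihilator E J" and v: "v \<in> V" for u v
  proof (rule antisym)
    show "nrm (dual E) (u + v) \<le> nrm (dual E) u + nrm (dual E) v"
      using annD(1)[OF u] v by (intro D.nrm_triangle) (auto simp: V_def)
    \<comment> \<open>Suprema are taken one after the other: over \<open>T\<close> with
      \<open>S\<close> fixed, then over \<open>S\<close>.\<close>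
    have "nrm (dual E) u \<le> nrm (dual E) (u + v) - norm (v S)"
      if "S \<in> carr E" "nrm E S \<le> 1" for S
      using additive_aux[OF u v _ _ that] by (intro d_le) (simp add: le_diff_eq)
    then have "nrm (dual E) v \<le> nrm (dual E) (u + v) - nrm (dual E) u"
      by (intro d_le) (simp add: algebra_simps)
    then show "nrm (dual E) u + nrm (dual E) v \<le> nrm (dual E) (u + v)" by simp
  qed

  have Cauchy_unit: "Cauchy (\<lambda>n. \<phi> (R n T))"
    if \<phi>: "\<phi> \<in> carr (dual E)" and T: "T \<in> carr E" "nrm E T \<le> 1" for \<phi> T
  proof -
    define N where "N = (SUP S\<in>{S \<in> J. nrm E S \<le> 1}. norm (\<phi> S))"
    have bd: "bdd_above ((\<lambda>S. norm (\<phi> S)) ` {S \<in> J. nrm E S \<le> 1})"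
    proof (rule bdd_aboveI2)
      fix S assume "S \<in> {S \<in> J. nrm E S \<le> 1}"
      then show "norm (\<phi> S) \<le> nrm (dual E) \<phi>"
        using d_bound[OF \<phi>, of S] J_sub D.nrm_nonneg[OF \<phi>] mult_left_mono[of "nrm E S" 1 "nrm (dual E) \<phi>"]
        by fastforce
    qed
    have ne: "0 \<in> {S \<in> J. nrm E S \<le> 1}" using E.subspace_0[OF J_sp] by simp
    have N0: "0 \<le> N"
      unfolding N_def by (rule cSUP_upper2[OF bd ne]) simp
    have N_le: "norm (\<phi> S) \<le> N * r" if S: "S \<in> J" "nrm E S \<le> r" "0 < r" for S r
    proof -
      have "scl E (of_real (1 / r)) S \<in> {S \<in> J. nrm E S \<le> 1}"
        using S J_sub E.subspace_scale[OF J_sp] by (auto simp: E.nrm_scl norm_divide)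
      then have "norm (\<phi> (scl E (of_real (1 / r)) S)) \<le> N"
        unfolding N_def by (rule cSUP_upper[OF _ bd])
      moreover have "\<phi> (scl E (of_real (1 / r)) S) = of_real (1 / r) * \<phi> S"
        using S J_sub by (intro d_scl \<phi>) auto
      ultimately have "norm (of_real (1 / r) * \<phi> S) \<le> N" by (simp only:)
      then have "norm (\<phi> S) / r \<le> N" using S by (simp add: norm_mult norm_divide)
      then show ?thesis using S by (simp add: pos_divide_le_eq)
    qed
    \<comment> \<open>First \<open>S\<close> is chosen, then \<open>n\<close> by
      \<open>R_est\<close>, then \<open>m\<close> large depending on both. The constant collects
      \<open>N * (1 + e)\<^sup>2 - N \<le> 3 * e * N\<close> and three errors \<open>e\<close>: the
      defect of \<open>S\<close>, and the replacement of \<open>R m (R n T)\<close> by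
      \<open>R n T\<close> and of \<open>R m S\<close> by \<open>S\<close>.\<close>
    have key: "\<exists>n. eventually (\<lambda>m. norm (\<phi> (R m T) - \<phi> (R n T)) \<le> e * (3 * N + 3)) sequentially"
      if e: "0 < e" "e \<le> 1" for e
    proof -
      have "{S \<in> J. nrm E S \<le> 1} \<noteq> {}" using ne by blast
      then have "(N - e < N) = (\<exists>S\<in>{S \<in> J. nrm E S \<le> 1}. N - e < norm (\<phi> S))"
        unfolding N_def by (rule less_cSUP_iff[OF _ bd])
      then obtain S where S: "S \<in> J" "nrm E S \<le> 1" "N - e < norm (\<phi> S)"
        using e by auto
      have Sc: "S \<in> carr E" using S J_sub by auto
      obtain n where n: "\<And>a. norm a = 1 \<Longrightarrow> nrm E (T - R n T + scl E a S) \<le> 1 + e"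
        using R_est[OF T(1) S(1) T(2) S(2) e(1)] by (auto simp: eventually_sequentially)
      have RJ: "R n T \<in> J" "R n T \<in> carr E" using R_mem[OF T(1)] R_carr[OF T(1)] by auto
      have 1: "eventually (\<lambda>m. norm (\<phi> (R m (R n T)) - \<phi> (R n T)) < e) sequentially"
        using tendstoD[OF scl_lim[OF \<phi> RJ(1)] e(1)] by (simp add: dist_norm)
      have 2: "eventually (\<lambda>m. norm (\<phi> (R m S) - \<phi> S) < e) sequentially"
        using tendstoD[OF scl_lim[OF \<phi> S(1)] e(1)] by (simp add: dist_norm)
      have 3: "eventually (\<lambda>m. c m < 1 + e) sequentially"
        using order_tendstoD(2)[OF c, of "1 + e"] e by simp
      from 1 2 3 have "eventually (\<lambda>m. norm (\<phi> (R m T) - \<phi> (R n T)) \<le> e * (3 * N + 3)) sequentially"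
      proof eventually_elim
        case (elim m)
        obtain a where a: "norm a = 1"
          "norm (\<phi> (R m T) - \<phi> (R n T) + a * \<phi> S) = norm (\<phi> (R m T) - \<phi> (R n T)) + norm (\<phi> S)"
          using exists_unimodular_aligned .
        define y where "y = T - R n T + scl E a S"
        have y: "y \<in> carr E" using T RJ Sc by (auto simp: y_def)
        have ny: "nrm E (R m y) \<le> (1 + e) * (1 + e)"
        proof -
          have "nrm E (R m y) \<le> c m * nrm E y" by (rule R_norm[OF y])
          also have "\<dots> \<le> (1 + e) * (1 + e)"
          proof (rule order_trans)
            show "c m * nrm E y \<le> (1 + e) * nrm E y"
              using elim E.nrm_nonneg[OF y] by (intro mult_right_mono) auto
            show "(1 + e) * nrm E y \<le> (1 + e) * (1 + e)"
              using e n[OF a(1)] by (intro mult_left_mono) (auto simp: y_def)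
          qed
          finally show ?thesis .
        qed
        have Ry: "R m y = R m T - R m (R n T) + scl E a (R m S)"
        proof -
          have "R m (T - R n T) + R m (R n T) = R m T"
            using R_add[OF E.carr_diff[OF T(1) RJ(2)] RJ(2), of m] by simp
          moreover have "R m y = R m (T - R n T) + scl E a (R m S)"
            unfolding y_def using R_add[OF E.carr_diff[OF T(1) RJ(2)] E.carr_scl[OF Sc]] R_scl[OF Sc] by simp
          ultimately show ?thesis by (simp add: eq_diff_eq)
        qed
        have "\<phi> (R m y) = \<phi> (R m T) - \<phi> (R m (R n T)) + a * \<phi> (R m S)"
          unfolding Ry
          using d_add[OF \<phi> E.carr_diff[OF R_carr[OF T(1)] R_carr[OF RJ(2)]] E.carr_scl[OF R_carr[OF Sc]]]
            d_diff[OF \<phi> R_carr[OF T(1)] R_carr[OF RJ(2)]] d_scl[OF \<phi> R_carr[OF Sc]] by simp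
        then have eq: "\<phi> (R m T) - \<phi> (R n T) + a * \<phi> S
            = \<phi> (R m y) + (\<phi> (R m (R n T)) - \<phi> (R n T)) - a * (\<phi> (R m S) - \<phi> S)"
          by (simp add: algebra_simps)
        have "norm (\<phi> (R m y)) \<le> N * ((1 + e) * (1 + e))"
          using ny e by (intro N_le R_mem y) auto
        moreover have "norm (a * (\<phi> (R m S) - \<phi> S)) < e" using a elim by (simp add: norm_mult)
        ultimately have "norm (\<phi> (R m T) - \<phi> (R n T) + a * \<phi> S) \<le> N * ((1 + e) * (1 + e)) + e + e"
          unfolding eq using elim(1)
          by (smt (verit) norm_triangle_ineq norm_triangle_ineq4)
        then have "norm (\<phi> (R m T) - \<phi> (R n T)) \<le> N * ((1 + e) * (1 + e)) - N + 3 * e"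
          using a S by simp
        also have "\<dots> = e * (2 * N + 3) + e * (e * N)" by (simp add: algebra_simps)
        also have "\<dots> \<le> e * (2 * N + 3) + e * (1 * N)"
          using e N0 by (intro add_left_mono mult_left_mono mult_right_mono) auto
        also have "\<dots> = e * (3 * N + 3)" by (simp add: algebra_simps)
        finally show ?case .
      qed
      then show ?thesis by blast
    qed
    show ?thesis
    proof (rule metric_CauchyI)
      fix r :: real assume r: "0 < r"
      \<comment> \<open>This makes the bound in \<open>key\<close> at most \<open>r / 3\<close>; two
        values compared through \<open>\<phi> (R n T)\<close> then differ by at most
        \<open>2 * r / 3\<close>.\<close>
      define e where "e = min 1 (r / (3 * (3 * N + 3)))"
      have e: "0 < e" "e \<le> 1" using r N0 by (auto simp: e_def)
      have "e * (3 * N + 3) \<le> r / (3 * (3 * N + 3)) * (3 * N + 3)"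
        using N0 by (intro mult_right_mono) (auto simp: e_def)
      also have "\<dots> = r / 3" using N0 by (simp add: divide_simps)
      finally have er: "e * (3 * N + 3) \<le> r / 3" .
      obtain n M where "\<And>m. m \<ge> M \<Longrightarrow> norm (\<phi> (R m T) - \<phi> (R n T)) \<le> e * (3 * N + 3)"
        using key[OF e] by (auto simp: eventually_sequentially)
      then have M: "\<And>m. m \<ge> M \<Longrightarrow> dist (\<phi> (R m T)) (\<phi> (R n T)) \<le> r / 3"
        using er by (force simp: dist_norm)
      have "dist (\<phi> (R i T)) (\<phi> (R j T)) < r" if "i \<ge> M" "j \<ge> M" for i j
        using M[OF that(1)] M[OF that(2)] dist_triangle2[of "\<phi> (R i T)" "\<phi> (R j T)" "\<phi> (R n T)"] r by linarith
      then show "\<exists>M. \<forall>i\<ge>M. \<forall>j\<ge>M. dist (\<phi> (R i T)) (\<phi> (R j T)) < r" by blast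
    qed
  qed
  have conv: "convergent (\<lambda>n. \<phi> (R n T))" if \<phi>: "\<phi> \<in> carr (dual E)" and T: "T \<in> carr E" for \<phi> T
  proof -
    \<comment> \<open>Adding \<open>1\<close> permits division by \<open>r\<close> even if
      \<open>T\<close> has norm zero.\<close>
    define r where "r = nrm E T + 1"
    have r: "0 < r" using E.nrm_nonneg[OF T] by (simp add: r_def)
    define T' where "T' = scl E (of_real (1 / r)) T"
    have "norm (of_real (1 / r) :: 'k) = 1 / r" using r by (simp add: norm_divide)
    then have "nrm E T' = nrm E T / r" by (simp only: T'_def E.nrm_scl[OF T]) simp
    moreover have "T' \<in> carr E" using T by (auto simp: T'_def)
    ultimately have T': "T' \<in> carr E" "nrm E T' \<le> 1"
      using r by (auto simp: r_def)
    have TT: "T = scl E (of_real r) T'" using r by (simp add: T'_def flip: of_real_mult)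
    have "convergent (\<lambda>n. \<phi> (R n T'))" using Cauchy_unit[OF \<phi> T'] by (simp add: Cauchy_convergent_iff)
    then have "convergent (\<lambda>n. of_real r * \<phi> (R n T'))"
      by (auto simp: convergent_def intro: tendsto_mult_left)
    moreover have "\<phi> (R n T) = of_real r * \<phi> (R n T')" for n
      using d_scl[OF \<phi> R_carr[OF T'(1)]] R_scl[OF T'(1)] TT by metis
    ultimately show ?thesis by simp
  qed

  have decomp: "\<exists>u v. \<phi> = u + v \<and> u \<in> annihilator E J \<and> v \<in> V" if \<phi>: "\<phi> \<in> carr (dual E)" for \<phi>
  proof -
    define v where "v T = (if T \<in> carr E then lim (\<lambda>n. \<phi> (R n T)) else 0)" for T
    have vl: "(\<lambda>n. \<phi> (R n T)) \<longlonglongrightarrow> v T" if "T \<in> carr E" for T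
      using conv[OF \<phi> that] that by (simp add: v_def convergent_LIMSEQ_iff)
    have v: "v \<in> carr (dual E)"
    proof (rule dI)
      fix S T assume ST: "S \<in> carr E" "T \<in> carr E"
      have "(\<lambda>n. \<phi> (R n (S + T))) \<longlonglongrightarrow> v S + v T"
        using tendsto_add[OF vl[OF ST(1)] vl[OF ST(2)]] R_add[OF ST] d_add[OF \<phi> R_carr[OF ST(1)] R_carr[OF ST(2)]]
        by simp
      then show "v (S + T) = v S + v T" using vl[of "S + T"] ST by (auto intro: LIMSEQ_unique)
    next
      fix a T assume T: "T \<in> carr E"
      have "(\<lambda>n. \<phi> (R n (scl E a T))) \<longlonglongrightarrow> a * v T"
        using tendsto_mult_left[OF vl[OF T]] R_scl[OF T] d_scl[OF \<phi> R_carr[OF T]] by simp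
      then show "v (scl E a T) = a * v T" using vl[of "scl E a T"] T by (auto intro: LIMSEQ_unique)
    next
      fix T assume T: "T \<in> carr E"
      have "norm (\<phi> (R n T)) \<le> nrm (dual E) \<phi> * B * nrm E T" for n
        using d_bound[OF \<phi> R_carr[OF T], of n] mult_left_mono[OF R_B[OF T, of n] D.nrm_nonneg[OF \<phi>]]
        by (simp add: mult.assoc)
      then show "norm (v T) \<le> (nrm (dual E) \<phi> * B) * nrm E T"
        by (intro tendsto_upperbound[OF tendsto_norm[OF vl[OF T]]]) auto
    qed (simp add: v_def)
    have vJ: "v S = \<phi> S" if "S \<in> J" for S
      using vl[of S] scl_lim[OF \<phi> that] J_sub that by (auto intro: LIMSEQ_unique)
    \<comment> \<open>Since \<open>v\<close> and \<open>\<phi>\<close> agree on \<open>J\<close>,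
      the values \<open>v (R n T) = \<phi> (R n T)\<close> converge to \<open>v T\<close> by the
      definition of \<open>v\<close>.\<close>
    have "v \<in> V"
      unfolding V_def
    proof (intro CollectI conjI ballI v)
      fix T assume T: "T \<in> carr E"
      have "(\<lambda>n. v T - \<phi> (R n T)) \<longlonglongrightarrow> v T - v T" by (intro tendsto_intros vl T)
      then show "(\<lambda>n. v (T - R n T)) \<longlonglongrightarrow> 0"
        using d_diff[OF v T R_carr[OF T]] vJ[OF R_mem[OF T]] by simp
    qed
    moreover have "\<phi> - v \<in> annihilator E J"
      using \<phi> v vJ by (auto simp: annihilator_def)
    ultimately show ?thesis by (intro exI[of _ "\<phi> - v"] exI[of _ v]) simp
  qed
  have inter: "annihilator E J \<inter> V = {0}"
  proof
    show "annihilator E J \<inter> V \<subseteq> {0}"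
    proof
      fix u assume u: "u \<in> annihilator E J \<inter> V"
      have "u T = 0" for T
      proof (cases "T \<in> carr E")
        case True
        \<comment> \<open>A functional in both spaces makes this sequence constant and null at
          once.\<close>
        have "u (T - R n T) = u T" for n
          using d_diff[OF annD(1) True R_carr[OF True], of u n] annD(2)[of u, OF _ R_mem[OF True]] u by simp
        moreover have "(\<lambda>n. u (T - R n T)) \<longlonglongrightarrow> 0" using u True by (auto simp: V_def)
        ultimately show ?thesis by (simp add: LIMSEQ_const_iff)
      qed (use u d_out in \<open>auto simp: annihilator_def\<close>)
      then show "u \<in> {0}" by (auto simp: fun_eq_iff)
    qed
    show "{0} \<subseteq> annihilator E J \<inter> V" by (auto simp: annihilator_def V_def)
  qed
  show ?thesis
    unfolding M_ideal_def
  proof (intro conjI exI[of _ V] ballI J V_closed inter additive)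
    show "carr (dual E) = {u + v |u v. u \<in> annihilator E J \<and> v \<in> V}"
      using decomp annD by (auto simp: V_def)
  qed
qed

section \<open>The space \<open>\<ell>\<^sub>p\<close>\<close>

lemma sum_powr_le:
  fixes x :: "nat \<Rightarrow> real"
  assumes "1 \<le> p" "\<And>i. 0 \<le> x i"
  shows "(\<Sum>i<M. x i powr p) \<le> (\<Sum>i<M. x i) powr p"
proof (induction M)
  case (Suc M)
  have "(\<Sum>i<Suc M. x i powr p) \<le> (\<Sum>i<M. x i) powr p + x M powr p" using Suc by simp
  also have "\<dots> \<le> (\<Sum>i<Suc M. x i) powr p"
    using powr_superadditive[of p "\<Sum>i<M. x i" "x M"] assms by (simp add: sum_nonneg)
  finally show ?case .
qed simp

definition head_part :: "nat \<Rightarrow> (nat \<Rightarrow> 'k::zero) \<Rightarrow> nat \<Rightarrow> 'k" where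
  "head_part M a = (\<lambda>i. if i < M then a i else 0)"

definition tail_part :: "nat \<Rightarrow> (nat \<Rightarrow> 'k::zero) \<Rightarrow> nat \<Rightarrow> 'k" where
  "tail_part M a = (\<lambda>i. if i < M then 0 else a i)"

lemma head_add_tail: "head_part M a + tail_part M a = (a :: nat \<Rightarrow> 'k::real_normed_field)"
  by (auto simp: head_part_def tail_part_def fun_eq_iff)

lemma tail_part_add: "tail_part M (a + b) = tail_part M a + tail_part M (b :: nat \<Rightarrow> 'k::real_normed_field)"
  and tail_part_diff: "tail_part M (a - b) = tail_part M a - tail_part M b"
  and tail_part_zero: "tail_part M 0 = (0 :: nat \<Rightarrow> 'k)"
  and tail_part_scl: "tail_part M (\<lambda>i. c * a i) = (\<lambda>i. c * tail_part M a i)"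
  by (auto simp: tail_part_def fun_eq_iff)

lemma carr_ell_iff: "a \<in> carr (ell p) \<longleftrightarrow> summable (\<lambda>i. norm (a i) powr p)"
  and nrm_ell: "nrm (ell p) a = (\<Sum>i. norm (a i) powr p) powr (1 / p)"
  and scl_ell: "scl (ell p) c a = (\<lambda>i. c * a i)"
  by (simp_all add: ell_def)

context
  fixes p :: real
  assumes p: "1 \<le> p"
begin

lemma nrm_ell_powr: "nrm (ell p) a powr p = (\<Sum>i. norm (a i) powr p)"
  if "a \<in> carr (ell p)" for a :: "nat \<Rightarrow> 'k::real_normed_field"
  using that p by (simp add: nrm_ell powr_powr carr_ell_iff suminf_nonneg)

lemma nrm_ell_nonneg: "0 \<le> nrm (ell p) a" for a :: "nat \<Rightarrow> 'k::real_normed_field"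
  by (simp add: nrm_ell)

lemma nrm_ell_le:
  fixes a :: "nat \<Rightarrow> 'k::real_normed_field"
  assumes "a \<in> carr (ell p)" "0 \<le> C" "(\<Sum>i. norm (a i) powr p) \<le> C powr p"
  shows "nrm (ell p) a \<le> C"
proof -
  have "nrm (ell p) a \<le> (C powr p) powr (1 / p)"
    unfolding nrm_ell using assms p by (intro powr_mono2) (auto simp: carr_ell_iff suminf_nonneg)
  then show ?thesis using assms p by (simp add: powr_powr)
qed

text \<open>The lattice property of \<open>ell p\<close>, from which membership and monotonicity of
  head and tail parts follow.\<close>

lemma ell_dominated:
  fixes a b :: "nat \<Rightarrow> 'k::real_normed_field"
  assumes b: "b \<in> carr (ell p)" and le: "\<And>i. norm (a i) \<le> norm (b i)"
  shows "a \<in> carr (ell p)" "nrm (ell p) a \<le> nrm (ell p) b"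
proof -
  have *: "norm (a i) powr p \<le> norm (b i) powr p" for i
    using le[of i] p by (intro powr_mono2) auto
  show a: "a \<in> carr (ell p)"
    unfolding carr_ell_iff
  proof (rule summable_comparison_test'[where N = 0])
    show "summable (\<lambda>i. norm (b i) powr p)" using b by (simp add: carr_ell_iff)
  qed (use * in auto)
  show "nrm (ell p) a \<le> nrm (ell p) b"
    using a b * nrm_ell_powr[OF b] nrm_ell_nonneg
    by (intro nrm_ell_le) (auto simp: carr_ell_iff intro: suminf_le)
qed

lemma head_part_ell: "a \<in> carr (ell p) \<Longrightarrow> head_part M a \<in> carr (ell p)"
  and tail_part_ell: "a \<in> carr (ell p) \<Longrightarrow> tail_part M a \<in> carr (ell p)"
  and nrm_head_part_le: "a \<in> carr (ell p) \<Longrightarrow> nrm (ell p) (head_part M a) \<le> nrm (ell p) a"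
  and nrm_tail_part_le: "a \<in> carr (ell p) \<Longrightarrow> nrm (ell p) (tail_part M a) \<le> nrm (ell p) a"
  for a :: "nat \<Rightarrow> 'k::real_normed_field"
  by - (erule ell_dominated; simp add: head_part_def tail_part_def)+

lemma nrm_tail_part_antimono:
  fixes a :: "nat \<Rightarrow> 'k::real_normed_field"
  assumes "a \<in> carr (ell p)" "M \<le> N"
  shows "nrm (ell p) (tail_part N a) \<le> nrm (ell p) (tail_part M a)"
  using assms by (intro ell_dominated(2)[OF tail_part_ell]) (auto simp: tail_part_def)

lemma norm_le_nrm_ell: "a \<in> carr (ell p) \<Longrightarrow> norm (a i) \<le> nrm (ell p) a"
  for a :: "nat \<Rightarrow> 'k::real_normed_field"
proof -
  assume a: "a \<in> carr (ell p)"
  have "norm (a i) = (norm (a i) powr p) powr (1 / p)" using p by (simp add: powr_powr)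
  also have "\<dots> \<le> nrm (ell p) a"
    unfolding nrm_ell using p a sum_le_suminf[of "\<lambda>i. norm (a i) powr p" "{i}"]
    by (intro powr_mono2) (auto simp: carr_ell_iff)
  finally show ?thesis .
qed

lemma ell_add_mem:
  fixes a b :: "nat \<Rightarrow> 'k::real_normed_field"
  assumes a: "a \<in> carr (ell p)" and b: "b \<in> carr (ell p)"
  shows "a + b \<in> carr (ell p)"
  unfolding carr_ell_iff
proof (rule summable_comparison_test'[of _ 0])
  show "summable (\<lambda>i. 2 powr p * (norm (a i) powr p + norm (b i) powr p))"
    using a b by (auto simp: carr_ell_iff intro!: summable_mult summable_add)
  fix i
  have "norm (a i + b i) powr p \<le> (norm (a i) + norm (b i)) powr p"
    using p by (intro powr_mono2 norm_triangle_ineq) auto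
  also have "\<dots> \<le> 2 powr p * (norm (a i) powr p + norm (b i) powr p)"
    using p by (intro powr_add_le) auto
  finally show "norm (norm ((a + b) i) powr p) \<le> 2 powr p * (norm (a i) powr p + norm (b i) powr p)"
    by simp
qed

lemma nrm_ell_eq_0D:
  fixes a :: "nat \<Rightarrow> 'k::real_normed_field"
  assumes "a \<in> carr (ell p)" "nrm (ell p) a = 0"
  shows "a = 0"
  using norm_le_nrm_ell[OF assms(1)] assms(2) by (auto simp: fun_eq_iff)

text \<open>For nonzero norms \<open>A\<close> and \<open>B\<close>, write the sum as
  \<open>A + B\<close> times the convex combination of the normalised sequences with weights
  \<open>A / (A + B)\<close> and \<open>B / (A + B)\<close>, and use convexity of the
  \<open>p\<close>-th power in each coordinate.\<close>

lemma minkowski: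
  fixes a b :: "nat \<Rightarrow> 'k::real_normed_field"
  assumes a: "a \<in> carr (ell p)" and b: "b \<in> carr (ell p)"
  shows "nrm (ell p) (a + b) \<le> nrm (ell p) a + nrm (ell p) b"
proof -
  define A B where "A = nrm (ell p) a" and "B = nrm (ell p) b"
  consider "A = 0" | "B = 0" | "0 < A" "0 < B"
    using nrm_ell_nonneg[of a] nrm_ell_nonneg[of b] by (fastforce simp: A_def B_def)
  then show ?thesis
  proof cases
    case 1
    then show ?thesis using nrm_ell_eq_0D[OF a] by (simp add: A_def)
  next
    case 2
    then show ?thesis using nrm_ell_eq_0D[OF b] by (simp add: B_def)
  next
    case 3
    define l where "l = A / (A + B)"
    have l: "0 \<le> l" "l \<le> 1" "(A + B) * l = A" "(A + B) * (1 - l) = B"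
      using 3 by (auto simp: l_def field_simps)
    define f where "f i = (A + B) powr p * (l * (norm (a i) powr p / A powr p) + (1 - l) * (norm (b i) powr p / B powr p))" for i
    have le: "norm ((a + b) i) powr p \<le> f i" for i
    proof -
      have "norm (a i) + norm (b i) = ((A + B) * l) * (norm (a i) / A) + ((A + B) * (1 - l)) * (norm (b i) / B)"
        using 3 by (simp add: l)
      also have "\<dots> = (A + B) * (l * (norm (a i) / A) + (1 - l) * (norm (b i) / B))"
        by (simp only: distrib_left mult.assoc)
      finally have e: "norm (a i) + norm (b i) = (A + B) * (l * (norm (a i) / A) + (1 - l) * (norm (b i) / B))" .
      have "norm ((a + b) i) powr p \<le> (norm (a i) + norm (b i)) powr p"
        using p by (auto intro!: powr_mono2 norm_triangle_ineq)
      also have "\<dots> = (A + B) powr p * (l * (norm (a i) / A) + (1 - l) * (norm (b i) / B)) powr p"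
        unfolding e by (rule powr_mult)
      also have "\<dots> \<le> (A + B) powr p * (l * (norm (a i) / A) powr p + (1 - l) * (norm (b i) / B) powr p)"
        using 3 l p by (intro mult_left_mono powr_convex_nonneg) auto
      also have "\<dots> = f i" using 3 by (simp add: f_def powr_divide)
      finally show ?thesis .
    qed
    have sa: "(\<lambda>i. norm (a i) powr p) sums (A powr p)"
      using a nrm_ell_powr[OF a] by (simp add: A_def carr_ell_iff summable_sums)
    have sb: "(\<lambda>i. norm (b i) powr p) sums (B powr p)"
      using b nrm_ell_powr[OF b] by (simp add: B_def carr_ell_iff summable_sums)
    have "f sums ((A + B) powr p * (l * (A powr p / A powr p) + (1 - l) * (B powr p / B powr p)))"
      unfolding f_def by (intro sums_mult sums_add sums_divide sa sb)
    then have f: "f sums ((A + B) powr p)" using 3 by simp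
    show ?thesis
      unfolding A_def[symmetric] B_def[symmetric]
    proof (rule nrm_ell_le)
      have "(\<Sum>i. norm ((a + b) i) powr p) \<le> suminf f"
        using ell_add_mem[OF a b] f le by (intro suminf_le) (auto simp: carr_ell_iff sums_iff)
      then show "(\<Sum>i. norm ((a + b) i) powr p) \<le> (A + B) powr p" using f by (simp add: sums_iff)
    qed (use ell_add_mem[OF a b] 3 in auto)
  qed
qed

lemma ell_scl_mem: "a \<in> carr (ell p) \<Longrightarrow> (\<lambda>i. c * a i) \<in> carr (ell p)"
  for a :: "nat \<Rightarrow> 'k::real_normed_field"
  using p by (simp add: carr_ell_iff norm_mult powr_mult summable_mult)

lemma normed_nspace_ell: "normed_nspace (ell p :: ('k::real_normed_field, nat \<Rightarrow> 'k) nspace)"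
proof -
  have vs: "vector_space (scl (ell p :: ('k, nat \<Rightarrow> 'k) nspace))"
    by unfold_locales (auto simp: scl_ell fun_eq_iff algebra_simps)
  then have m: "module (scl (ell p :: ('k, nat \<Rightarrow> 'k) nspace))" by (simp add: module_iff_vector_space)
  show ?thesis
    unfolding normed_nspace_def
  proof (intro conjI allI impI vs minkowski)
    show "module.subspace (scl (ell p)) (carr (ell p :: ('k, nat \<Rightarrow> 'k) nspace))"
      using p by (intro module.subspaceI[OF m] ell_add_mem)
        (auto simp: scl_ell ell_scl_mem carr_ell_iff[of 0])
    fix x :: "nat \<Rightarrow> 'k" and c :: 'k
    assume x: "x \<in> carr (ell p)"
    have "(\<Sum>i. norm (c * x i) powr p) = norm c powr p * (\<Sum>i. norm (x i) powr p)"
      using x by (simp add: norm_mult powr_mult suminf_mult carr_ell_iff)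
    then show "nrm (ell p) (scl (ell p) c x) = norm c * nrm (ell p) x"
      using x p by (simp add: nrm_ell scl_ell powr_mult powr_powr carr_ell_iff suminf_nonneg)
  qed auto
qed

text \<open>Disjoint supports make \<open>p\<close>-th powers of norms additive. This feature of the
  target space is what matches Clarkson's inequality in the domain.\<close>

lemma nrm_head_add_tail:
  fixes a b :: "nat \<Rightarrow> 'k::real_normed_field"
  assumes a: "a \<in> carr (ell p)" and b: "b \<in> carr (ell p)"
  shows "nrm (ell p) (head_part M a + tail_part M b) powr p
    = nrm (ell p) (head_part M a) powr p + nrm (ell p) (tail_part M b) powr p"
proof -
  note h = head_part_ell[OF a, of M] and t = tail_part_ell[OF b, of M]
  have "(\<Sum>i. norm ((head_part M a + tail_part M b) i) powr p)
      = (\<Sum>i. norm (head_part M a i) powr p + norm (tail_part M b i) powr p)"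
    using p by (intro suminf_cong) (auto simp: head_part_def tail_part_def)
  then show ?thesis
    using h t ell_add_mem[OF h t] by (simp add: nrm_ell_powr suminf_add carr_ell_iff)
qed

lemma nrm_head_part_le_sum:
  fixes a :: "nat \<Rightarrow> 'k::real_normed_field"
  assumes a: "a \<in> carr (ell p)"
  shows "nrm (ell p) (head_part M a) \<le> (\<Sum>i<M. norm (a i))"
proof (rule nrm_ell_le[OF head_part_ell[OF a]])
  have "(\<Sum>i. norm (head_part M a i) powr p) = (\<Sum>i<M. norm (head_part M a i) powr p)"
    using p by (intro suminf_finite) (auto simp: head_part_def)
  also have "\<dots> = (\<Sum>i<M. norm (a i) powr p)" by (simp add: head_part_def)
  also have "\<dots> \<le> (\<Sum>i<M. norm (a i)) powr p" using p by (intro sum_powr_le) auto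
  finally show "(\<Sum>i. norm (head_part M a i) powr p) \<le> (\<Sum>i<M. norm (a i)) powr p" .
qed (simp add: sum_nonneg)

lemma nrm_tail_part_tendsto_0:
  fixes a :: "nat \<Rightarrow> 'k::real_normed_field"
  assumes a: "a \<in> carr (ell p)"
  shows "(\<lambda>M. nrm (ell p) (tail_part M a)) \<longlonglongrightarrow> 0"
proof -
  define S where "S = (\<Sum>i. norm (a i) powr p)"
  have su: "summable (\<lambda>i. norm (a i) powr p)" using a by (simp add: carr_ell_iff)
  have "(\<Sum>i. norm (tail_part M a i) powr p) = S - (\<Sum>i<M. norm (a i) powr p)" for M
  proof -
    have "(\<lambda>i. norm (a i) powr p - (if i \<in> {..<M} then norm (a i) powr p else 0)) sums (S - (\<Sum>i<M. norm (a i) powr p))"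
      unfolding S_def by (intro sums_diff summable_sums su sums_If_finite_set) auto
    moreover have "(\<lambda>i. norm (a i) powr p - (if i \<in> {..<M} then norm (a i) powr p else 0))
        = (\<lambda>i. norm (tail_part M a i) powr p)"
      using p by (auto simp: tail_part_def fun_eq_iff)
    ultimately show ?thesis by (simp add: sums_iff)
  qed
  then have eq: "nrm (ell p) (tail_part M a) = (S - (\<Sum>i<M. norm (a i) powr p)) powr (1 / p)" for M
    by (simp add: nrm_ell)
  have "(\<lambda>M. S - (\<Sum>i<M. norm (a i) powr p)) \<longlonglongrightarrow> S - S"
    unfolding S_def by (intro tendsto_intros summable_LIMSEQ su)
  moreover have "\<forall>M. 0 \<le> S - (\<Sum>i<M. norm (a i) powr p)"
    using sum_le_suminf[OF su] by (simp add: S_def)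
  ultimately have "(\<lambda>M. (S - (\<Sum>i<M. norm (a i) powr p)) powr (1 / p)) \<longlonglongrightarrow> 0 powr (1 / p)"
    using p by (intro tendsto_powr') auto
  then show ?thesis by (simp add: eq)
qed

text \<open>Fatou's lemma for coordinatewise limits: the bound passes to the limit in every finite
  partial sum, and partial sums determine the norm.\<close>

lemma ell_fatou:
  fixes z :: "nat \<Rightarrow> nat \<Rightarrow> 'k::real_normed_field"
  assumes z: "\<And>n. z n \<in> carr (ell p)" "\<And>n. nrm (ell p) (z n) \<le> C"
    and lim: "\<And>i. (\<lambda>n. z n i) \<longlonglongrightarrow> y i"
  shows "y \<in> carr (ell p)" "nrm (ell p) y \<le> C"
proof -
  have C: "0 \<le> C" using nrm_ell_nonneg[of "z 0"] z(2)[of 0] by linarith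
  have bd: "(\<Sum>i<N. norm (y i) powr p) \<le> C powr p" for N
  proof (rule tendsto_upperbound)
    show "(\<lambda>n. \<Sum>i<N. norm (z n i) powr p) \<longlonglongrightarrow> (\<Sum>i<N. norm (y i) powr p)"
      using p by (intro tendsto_sum tendsto_powr' tendsto_norm lim tendsto_const) auto
    show "\<forall>\<^sub>F n in sequentially. (\<Sum>i<N. norm (z n i) powr p) \<le> C powr p"
    proof (rule always_eventually, rule allI)
      fix n
      have "(\<Sum>i<N. norm (z n i) powr p) \<le> nrm (ell p) (z n) powr p"
        unfolding nrm_ell_powr[OF z(1)] using z(1)[of n] by (intro sum_le_suminf) (auto simp: carr_ell_iff)
      also have "\<dots> \<le> C powr p" using p z(2)[of n] nrm_ell_nonneg by (intro powr_mono2) auto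
      finally show "(\<Sum>i<N. norm (z n i) powr p) \<le> C powr p" .
    qed
  qed simp
  then have "summable (\<lambda>i. norm (y i) powr p)" by (intro summableI_nonneg_bounded) auto
  then show y: "y \<in> carr (ell p)" by (simp add: carr_ell_iff)
  show "nrm (ell p) y \<le> C"
    using C bd y by (intro nrm_ell_le suminf_le_const) (auto simp: carr_ell_iff)
qed

end

text \<open>A bounded subset of \<open>ell p\<close> is relatively compact exactly if its tails are
  uniformly small. In this form compactness of an operator becomes a norm estimate.\<close>

lemma compact_ops_ell_iff:
  fixes E :: "('k::{real_normed_field, euclidean_space}, 'v::ab_group_add) nspace"
  assumes E: "normed_nspace E" and p: "1 \<le> p"
  shows "T \<in> compact_ops E (ell p) \<longleftrightarrow> T \<in> carr (op_space E (ell p)) \<and>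
    (\<forall>e>0. \<exists>M. \<forall>x\<in>carr E. nrm E x \<le> 1 \<longrightarrow> nrm (ell p) (tail_part M (T x)) \<le> e)"
    (is "_ \<longleftrightarrow> _ \<and> ?tails")
proof -
  interpret nspace_pair E "ell p" using E normed_nspace_ell[OF p] by (simp add: nspace_pair_def)
  have ?tails if T: "T \<in> compact_ops E (ell p)"
  proof (rule ccontr)
    assume "\<not> ?tails"
    then obtain e where e: "0 < e"
      "\<forall>M. \<exists>x\<in>carr E. nrm E x \<le> 1 \<and> e < nrm (ell p) (tail_part M (T x))"
      by (auto simp: not_le)
    then obtain x where x: "\<And>M. x M \<in> carr E" "\<And>M. nrm E (x M) \<le> 1"
      "\<And>M. e < nrm (ell p) (tail_part M (T (x M)))" by metis
    have op: "T \<in> carr (op_space E (ell p))" using T by (simp add: compact_ops_def)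
    have "\<forall>n. x n \<in> carr E \<and> nrm E (x n) \<le> 1" using x by blast
    then have "\<exists>y\<in>carr (ell p). \<exists>r. strict_mono r \<and> (\<lambda>n. nrm (ell p) (T (x (r n)) - y)) \<longlonglongrightarrow> 0"
      using T by (simp add: compact_ops_def)
    then obtain y r where y: "y \<in> carr (ell p)" and r: "strict_mono r"
      and lim: "(\<lambda>n. nrm (ell p) (T (x (r n)) - y)) \<longlonglongrightarrow> 0"
      by blast
    \<comment> \<open>The tail index runs along the same subsequence, so the tails of the fixed
      limit \<open>y\<close> vanish as well, against the choice of \<open>x\<close>.\<close>
    have "(\<lambda>n. nrm (ell p) (T (x (r n)) - y) + nrm (ell p) (tail_part (r n) y)) \<longlonglongrightarrow> 0 + 0"
      using LIMSEQ_subseq_LIMSEQ[OF nrm_tail_part_tendsto_0[OF p y] r] lim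
      by (intro tendsto_add) (auto simp: o_def)
    then have "eventually (\<lambda>n. nrm (ell p) (T (x (r n)) - y) + nrm (ell p) (tail_part (r n) y) < e) sequentially"
      using e by (intro order_tendstoD) auto
    then obtain n where n: "nrm (ell p) (T (x (r n)) - y) + nrm (ell p) (tail_part (r n) y) < e"
      by (meson eventually_sequentially order_refl)
    have m: "T (x (r n)) \<in> carr (ell p)" "T (x (r n)) - y \<in> carr (ell p)"
      using op_mem[OF op x(1)] y by auto
    have "tail_part (r n) (T (x (r n))) = tail_part (r n) (T (x (r n)) - y) + tail_part (r n) y"
      by (simp add: tail_part_diff)
    then have "nrm (ell p) (tail_part (r n) (T (x (r n))))
        \<le> nrm (ell p) (tail_part (r n) (T (x (r n)) - y)) + nrm (ell p) (tail_part (r n) y)"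
      using minkowski[OF p tail_part_ell[OF p m(2)] tail_part_ell[OF p y]] by metis
    also have "\<dots> < e" using nrm_tail_part_le[OF p m(2), of "r n"] n by linarith
    finally show False using x(3)[of "r n"] by simp
  qed
  moreover have "T \<in> compact_ops E (ell p)" if op: "T \<in> carr (op_space E (ell p))" and tails: ?tails
    unfolding compact_ops_def
  proof (intro CollectI conjI op allI impI)
    fix x :: "nat \<Rightarrow> 'v" assume x: "\<forall>n. x n \<in> carr E \<and> nrm E (x n) \<le> 1"
    define z where "z n = T (x n)" for n
    define C where "C = op_norm E (ell p) T"
    have z: "z n \<in> carr (ell p)" "nrm (ell p) (z n) \<le> C" for n
      using x op_mem[OF op] nrm_le_op_norm[OF op] by (auto simp: z_def C_def)
    have "norm (z n i) \<le> C" for n i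
      using norm_le_nrm_ell[OF p z(1)] z(2) order_trans by blast
    \<comment> \<open>A diagonal subsequence converging in every coordinate; it exists because the
      coordinates are bounded scalars.\<close>
    then obtain r where r: "strict_mono r" "\<And>i. i \<in> UNIV \<Longrightarrow> \<exists>l. (\<lambda>n. z (r n) i) \<longlonglongrightarrow> l"
      by (rule function_convergent_subsequence[of "UNIV :: nat set" z C, OF countableI_type]) blast
    then obtain y where y: "\<And>i. (\<lambda>n. z (r n) i) \<longlonglongrightarrow> y i" by (metis UNIV_I)
    have yc: "y \<in> carr (ell p)" using ell_fatou(1)[OF p z y] .
    have "(\<lambda>n. nrm (ell p) (z (r n) - y)) \<longlonglongrightarrow> 0"
    proof (rule LIMSEQ_I)
      fix e :: real assume e: "0 < e"
      \<comment> \<open>The distance to \<open>y\<close> is split into the head of the difference, a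
        finite sum tending to \<open>0\<close>, and the two tails; each contributes at most
        \<open>e / 4\<close>.\<close>
      then obtain M where M: "\<And>x. x \<in> carr E \<Longrightarrow> nrm E x \<le> 1 \<Longrightarrow> nrm (ell p) (tail_part M (T x)) \<le> e / 4"
        using tails by (meson zero_less_divide_iff zero_less_numeral)
      have Mz: "nrm (ell p) (tail_part M (z n)) \<le> e / 4" for n using M x by (simp add: z_def)
      have "(\<lambda>n. tail_part M (z (r n)) i) \<longlonglongrightarrow> tail_part M y i" for i
        using y by (auto simp: tail_part_def)
      then have My: "nrm (ell p) (tail_part M y) \<le> e / 4"
        by (rule ell_fatou(2)[OF p tail_part_ell[OF p z(1)] Mz])
      have "(\<lambda>n. \<Sum>i<M. norm (z (r n) i - y i)) \<longlonglongrightarrow> (\<Sum>i<M. norm (y i - y i))"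
        by (intro tendsto_intros y)
      then have "eventually (\<lambda>n. (\<Sum>i<M. norm ((z (r n) - y) i)) < e / 4) sequentially"
        using e by (intro order_tendstoD) auto
      then have "eventually (\<lambda>n. norm (nrm (ell p) (z (r n) - y) - 0) < e) sequentially"
      proof eventually_elim
        case (elim n)
        have w: "z (r n) - y \<in> carr (ell p)" using z yc by auto
        have "nrm (ell p) (z (r n) - y) \<le> nrm (ell p) (head_part M (z (r n) - y)) + nrm (ell p) (tail_part M (z (r n) - y))"
          using minkowski[OF p head_part_ell[OF p w, of M] tail_part_ell[OF p w, of M]]
          unfolding head_add_tail .
        moreover have "nrm (ell p) (tail_part M (z (r n) - y)) \<le> nrm (ell p) (tail_part M (z (r n))) + nrm (ell p) (tail_part M y)"
          unfolding tail_part_diff by (intro cod.nrm_triangle_diff tail_part_ell p z yc)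
        ultimately have "nrm (ell p) (z (r n) - y) < e"
          using nrm_head_part_le_sum[OF p w, of M] elim Mz[of "r n"] My e by linarith
        then show ?case using nrm_ell_nonneg[OF p, of "z (r n) - y"] by simp
      qed
      then show "\<exists>n0. \<forall>n\<ge>n0. norm (nrm (ell p) (z (r n) - y) - 0) < e"
        by (simp add: eventually_sequentially)
    qed
    then show "\<exists>y\<in>carr (ell p). \<exists>r. strict_mono r \<and> (\<lambda>n. nrm (ell p) (T (x (r n)) - y)) \<longlonglongrightarrow> 0"
      using r(1) yc by (auto simp: z_def)
  qed
  ultimately show ?thesis by (auto simp: compact_ops_def)
qed

text \<open>By the tail criterion, sums, multiples and norm limits reduce to estimates of tails on
  the unit ball. For a sum the larger of the two cutting indices serves both summands.\<close>

lemma closed_subspace_compact_ops_ell: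
  fixes E :: "('k::{real_normed_field, euclidean_space}, 'v::ab_group_add) nspace"
  assumes E: "normed_nspace E" and p: "1 \<le> p"
  shows "closed_subspace (op_space E (ell p)) (compact_ops E (ell p))"
proof -
  interpret nspace_pair E "ell p" using E normed_nspace_ell[OF p] by (simp add: nspace_pair_def)
  interpret L: normed_nspace "op_space E (ell p)" by (rule normed_nspace_op_space)
  note iff = compact_ops_ell_iff[OF E p]
  show ?thesis
    unfolding closed_subspace_def
  proof (intro conjI allI impI)
    show "compact_ops E (ell p) \<subseteq> carr (op_space E (ell p))" by (auto simp: compact_ops_def)
    show "L.subspace (compact_ops E (ell p))"
    proof (rule L.subspaceI)
      show "0 \<in> compact_ops E (ell p)" by (auto simp: iff tail_part_zero)
    next
      fix S T assume S: "S \<in> compact_ops E (ell p)" and T: "T \<in> compact_ops E (ell p)"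
      have op: "S \<in> carr (op_space E (ell p))" "T \<in> carr (op_space E (ell p))"
        using S T by (auto simp: compact_ops_def)
      show "S + T \<in> compact_ops E (ell p)"
        unfolding iff
      proof (intro conjI allI impI)
        fix e :: real assume "0 < e"
        then obtain M N where MN: "\<And>x. x \<in> carr E \<Longrightarrow> nrm E x \<le> 1 \<Longrightarrow> nrm (ell p) (tail_part M (S x)) \<le> e / 2"
          "\<And>x. x \<in> carr E \<Longrightarrow> nrm E x \<le> 1 \<Longrightarrow> nrm (ell p) (tail_part N (T x)) \<le> e / 2"
          using S T unfolding iff by (meson half_gt_zero)
        have "nrm (ell p) (tail_part (max M N) ((S + T) x)) \<le> e" if x: "x \<in> carr E" "nrm E x \<le> 1" for x
        proof -
          note m = op_mem[OF op(1) x(1)] op_mem[OF op(2) x(1)]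
          have "nrm (ell p) (tail_part (max M N) ((S + T) x))
              \<le> nrm (ell p) (tail_part (max M N) (S x)) + nrm (ell p) (tail_part (max M N) (T x))"
            using minkowski[OF p tail_part_ell[OF p m(1)] tail_part_ell[OF p m(2)]] by (simp add: tail_part_add)
          then show ?thesis
            using nrm_tail_part_antimono[OF p m(1), of M "max M N"] nrm_tail_part_antimono[OF p m(2), of N "max M N"]
              MN[OF x] by simp
        qed
        then show "\<exists>M. \<forall>x\<in>carr E. nrm E x \<le> 1 \<longrightarrow> nrm (ell p) (tail_part M ((S + T) x)) \<le> e" by blast
      qed (rule L.carr_add[OF op])
    next
      fix c T assume T: "T \<in> compact_ops E (ell p)"
      have op: "T \<in> carr (op_space E (ell p))" using T by (auto simp: compact_ops_def)
      show "scl (op_space E (ell p)) c T \<in> compact_ops E (ell p)"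
        unfolding iff
      proof (intro conjI allI impI)
        fix e :: real assume e: "0 < e"
        \<comment> \<open>The summand \<open>1\<close> covers the scalar
          \<open>c = 0\<close>.\<close>
        define d where "d = e / (norm c + 1)"
        have d: "0 < d" using e by (simp add: d_def add_nonneg_pos)
        have "norm c + 1 \<noteq> 0" using norm_ge_zero[of c] by linarith
        then have "(norm c + 1) * d = e" by (simp add: d_def)
        then have cd: "norm c * d \<le> e" using d by (simp add: distrib_right)
        obtain M where M: "\<And>x. x \<in> carr E \<Longrightarrow> nrm E x \<le> 1 \<Longrightarrow> nrm (ell p) (tail_part M (T x)) \<le> d"
          using T d unfolding iff by meson
        have "nrm (ell p) (tail_part M (scl (op_space E (ell p)) c T x)) \<le> e" if x: "x \<in> carr E" "nrm E x \<le> 1" for x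
        proof -
          have "tail_part M (scl (op_space E (ell p)) c T x) = scl (ell p) c (tail_part M (T x))"
            by (simp add: scl_ell tail_part_scl)
          then have "nrm (ell p) (tail_part M (scl (op_space E (ell p)) c T x)) = norm c * nrm (ell p) (tail_part M (T x))"
            using cod.nrm_scl[OF tail_part_ell[OF p op_mem[OF op x(1)]]] by simp
          also have "\<dots> \<le> norm c * d" by (intro mult_left_mono M x) auto
          finally show ?thesis using cd by simp
        qed
        then show "\<exists>M. \<forall>x\<in>carr E. nrm E x \<le> 1 \<longrightarrow>
            nrm (ell p) (tail_part M (scl (op_space E (ell p)) c T x)) \<le> e" by blast
      qed (rule L.carr_scl[OF op])
    qed
    fix z T
    assume *: "(\<forall>n. z n \<in> compact_ops E (ell p)) \<and> T \<in> carr (op_space E (ell p)) \<and>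
      (\<lambda>n::nat. nrm (op_space E (ell p)) (z n - T)) \<longlonglongrightarrow> 0"
    then have T: "T \<in> carr (op_space E (ell p))" by blast
    show "T \<in> compact_ops E (ell p)"
      unfolding iff
    proof (intro conjI allI impI T)
      fix e :: real assume e: "0 < e"
      have "eventually (\<lambda>n. nrm (op_space E (ell p)) (z n - T) < e / 2) sequentially"
        using * e by (intro order_tendstoD(2)[where y = 0]) auto
      then obtain n where n: "op_norm E (ell p) (z n - T) < e / 2"
        by (auto simp: eventually_sequentially)
      have zn: "z n \<in> carr (op_space E (ell p))" using * by (auto simp: compact_ops_def)
      obtain M where M: "\<And>x. x \<in> carr E \<Longrightarrow> nrm E x \<le> 1 \<Longrightarrow> nrm (ell p) (tail_part M (z n x)) \<le> e / 2"
        using * e unfolding iff by (meson half_gt_zero)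
      have "nrm (ell p) (tail_part M (T x)) \<le> e" if x: "x \<in> carr E" "nrm E x \<le> 1" for x
      proof -
        have m: "z n x \<in> carr (ell p)" "(z n - T) x \<in> carr (ell p)"
          using op_mem[OF zn x(1)] op_mem[OF L.carr_diff[OF zn T] x(1)] by auto
        have "T x = z n x - (z n - T) x" by simp
        then have "nrm (ell p) (tail_part M (T x))
            \<le> nrm (ell p) (tail_part M (z n x)) + nrm (ell p) (tail_part M ((z n - T) x))"
          using cod.nrm_triangle_diff[OF tail_part_ell[OF p m(1)] tail_part_ell[OF p m(2)]]
          by (metis tail_part_diff)
        moreover have "nrm (ell p) (tail_part M ((z n - T) x)) \<le> op_norm E (ell p) (z n - T)"
          using nrm_tail_part_le[OF p m(2), of M] nrm_le_op_norm[OF L.carr_diff[OF zn T] x] by linarith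
        ultimately show ?thesis using M[OF x] n by linarith
      qed
      then show "\<exists>M. \<forall>x\<in>carr E. nrm E x \<le> 1 \<longrightarrow> nrm (ell p) (tail_part M (T x)) \<le> e" by blast
    qed
  qed
qed

section \<open>Compact approximations of the identity\<close>

context banach_over
begin

lemma normed_nspace_type_space: "normed_nspace (type_space smul)"
  by (simp add: normed_nspace_def vector_space_axioms norm_triangle_ineq norm_scale)

lemma bounded_linear_scale: "bounded_linear (smul c)"
proof (rule bounded_linear_intro)
  show "smul c (x + y) = smul c x + smul c y" for x y by (rule scale_right_distrib)
  show "smul c (r *\<^sub>R x) = r *\<^sub>R smul c x" for r x
    by (simp add: mult.commute flip: scale_of_real)
  show "norm (smul c x) \<le> norm x * norm c" for x by (simp add: norm_scale mult.commute)
qed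

lemma tendsto_scale_left:
  assumes "f \<longlonglongrightarrow> k"
  shows "(\<lambda>n. smul (f n) x) \<longlonglongrightarrow> smul k x"
proof -
  have "(\<lambda>n. smul (f n) x - smul k x) \<longlonglongrightarrow> 0"
  proof (rule tendsto_norm_zero_cancel)
    have "(\<lambda>n. norm (f n - k) * norm x) \<longlonglongrightarrow> norm (k - k) * norm x"
      by (intro tendsto_intros assms)
    then show "(\<lambda>n. norm (smul (f n) x - smul k x)) \<longlonglongrightarrow> 0"
      by (simp add: norm_scale flip: scale_left_diff_distrib)
  qed
  then show ?thesis by (simp add: LIM_zero_iff)
qed

text \<open>Bolzano-Weierstrass by induction on the spanning set. A new vector \<open>b\<close>
  outside \<open>span F\<close> has positive distance \<open>d\<close> from it, so the coefficients
  of \<open>b\<close> are bounded by \<open>C / d\<close>; a subsequence of them converges, and the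
  remainders are handled by the induction hypothesis.\<close>

lemma bounded_span_convergent_subsequence:
  assumes "finite B" "\<And>n. x n \<in> span B" "\<And>n::nat. norm (x n) \<le> C"
  shows "\<exists>y\<in>span B. \<exists>r::nat \<Rightarrow> nat. strict_mono r \<and> (\<lambda>n. x (r n)) \<longlonglongrightarrow> y"
  using assms
proof (induction B arbitrary: x C rule: finite_induct)
  case empty
  then show ?case by (auto intro!: exI[of _ id] strict_mono_id)
next
  case (insert b F)
  show ?case
  proof (cases "b \<in> span F")
    case True
    then show ?thesis using insert.IH[of x C] insert.prems by (simp add: span_redundant)
  next
    case False
    \<comment> \<open>The induction hypothesis itself gives closedness, which makes the distance of
      \<open>b\<close> from the span positive.\<close>
    have "closed (span F)"
      unfolding closed_sequential_limits
    proof (intro allI impI)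
      fix z l assume z: "(\<forall>n. z n \<in> span F) \<and> z \<longlonglongrightarrow> l"
      then obtain D where "\<And>n. norm (z n) \<le> D"
        using convergent_imp_Bseq[of z] by (auto simp: convergent_def Bseq_def)
      then obtain y r where y: "y \<in> span F" "strict_mono r" "(\<lambda>n. z (r n)) \<longlonglongrightarrow> y"
        using insert.IH[of z D] z by blast
      then have "l = y"
        using z LIMSEQ_subseq_LIMSEQ[of z l r] by (auto simp: o_def intro: LIMSEQ_unique)
      then show "l \<in> span F" using y by simp
    qed
    moreover have ne: "span F \<noteq> {}" using span_zero by blast
    ultimately have d: "0 < infdist b (span F)"
      using False in_closed_iff_infdist_zero[of "span F" b] infdist_nonneg[of b "span F"] by simp
    define d where "d = infdist b (span F)"
    have "\<forall>n. \<exists>k. x n - smul k b \<in> span F"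
      using insert.prems(1) by (simp add: span_breakdown_eq)
    then obtain k where k: "\<And>n. x n - smul (k n) b \<in> span F" by metis
    have kd: "norm (k n) * d \<le> norm (x n)" for n
    proof (cases "k n = 0")
      case False
      \<comment> \<open>The point of \<open>span F\<close> for which \<open>k n\<close> times
        \<open>b - g\<close> is \<open>x n\<close>.\<close>
      define g where "g = smul (- inverse (k n)) (x n - smul (k n) b)"
      have "g \<in> span F" unfolding g_def by (intro span_scale k)
      then have "d \<le> norm (b - g)" unfolding d_def by (metis dist_norm infdist_le)
      then have "norm (k n) * d \<le> norm (smul (k n) (b - g))"
        by (simp add: norm_scale mult_left_mono)
      also have "smul (k n) (b - g) = x n"
        using False by (simp add: g_def scale_right_diff_distrib)
      finally show ?thesis .
    qed simp
    have "norm (k n) \<le> C / d" for n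
      using order_trans[OF kd insert.prems(2)] d by (simp add: d_def pos_le_divide_eq)
    then have kb: "\<And>n. norm (k n) \<le> C / d" .
    then have "bounded (range k)" by (auto simp: bounded_iff)
    then obtain \<kappa> r1 where r1: "strict_mono r1" "(k \<circ> r1) \<longlonglongrightarrow> \<kappa>"
      using bounded_imp_convergent_subsequence by metis
    define f where "f n = x (r1 n) - smul (k (r1 n)) b" for n
    have f_span: "f n \<in> span F" for n by (simp add: f_def k)
    have f_bound: "norm (f n) \<le> C + C / d * norm b" for n
      using norm_triangle_ineq4[of "x (r1 n)" "smul (k (r1 n)) b"] insert.prems(2)[of "r1 n"]
        mult_right_mono[OF kb[of "r1 n"] norm_ge_zero[of b]]
      by (simp add: f_def norm_scale)
    then obtain y r2 where y: "y \<in> span F" "strict_mono r2" "(\<lambda>n. f (r2 n)) \<longlonglongrightarrow> y"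
      using insert.IH[of f, OF f_span f_bound] by blast
    have "(\<lambda>n. f (r2 n) + smul (k (r1 (r2 n))) b) \<longlonglongrightarrow> y + smul \<kappa> b"
      using LIMSEQ_subseq_LIMSEQ[OF r1(2) y(2)]
      by (intro tendsto_add y tendsto_scale_left) (simp add: o_def)
    moreover have "y + smul \<kappa> b \<in> span (insert b F)"
      using y(1) by (intro span_add span_scale span_base[of b]) (auto intro: span_superset[THEN subsetD] rev_subsetD[OF _ span_mono[of F "insert b F"]])
    ultimately show ?thesis
      using strict_mono_o[OF r1(1) y(2)]
      by (intro bexI[of _ "y + smul \<kappa> b"] exI[of _ "r1 \<circ> r2"]) (simp_all add: f_def o_def)
  qed
qed

section \<open>Approximating compact operators from either hypothesis on the space\<close>

lemma compact_op_props:
  assumes "K \<in> compact_ops (type_space smul) (type_space smul)"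
  shows "K (x + y) = K x + K y" "K (smul a x) = smul a (K x)" "K (t *\<^sub>R x) = t *\<^sub>R K x"
    "bounded_linear K"
proof -
  have op: "K \<in> carr (op_space (type_space smul) (type_space smul))"
    using assms by (simp add: compact_ops_def)
  then obtain C where C: "\<And>x. norm (K x) \<le> C * norm x" by (auto simp: op_space_def)
  show add: "K (x + y) = K x + K y" and "K (smul a x) = smul a (K x)" for x y a
    using op by (auto simp: op_space_def linear_map_def)
  then show scaleR: "K (t *\<^sub>R x) = t *\<^sub>R K x" for t x
    by (metis scale_of_real)
  show "bounded_linear K"
    by (rule bounded_linear_intro[of _ C]) (use add scaleR C in \<open>auto simp: mult.commute\<close>)
qed

text \<open>Brings the property into the form also available for decompositions, with a pointwise
  bound in place of the operator norm; \<open>c n\<close> is that operator norm.\<close>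

lemma UMCAP_approximation:
  assumes "UMCAP smul"
  shows "\<exists>K c. (\<forall>n. K n \<in> compact_ops (type_space smul) (type_space smul)) \<and>
    (\<forall>x. (\<lambda>n. K n x) \<longlonglongrightarrow> x) \<and> (\<forall>n x. norm (x - 2 *\<^sub>R K n x) \<le> c n * norm x) \<and> c \<longlonglongrightarrow> 1"
proof -
  obtain K where K: "\<And>n. K n \<in> compact_ops (type_space smul) (type_space smul)"
    "\<And>x. (\<lambda>n. K n x) \<longlonglongrightarrow> x" "(\<lambda>n. onorm (\<lambda>x. x - 2 *\<^sub>R K n x)) \<longlonglongrightarrow> 1"
    using assms by (auto simp: UMCAP_def)
  have "bounded_linear (\<lambda>x. x - 2 *\<^sub>R K n x)" for n
    using compact_op_props(4)[OF K(1)]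
    by (intro bounded_linear_sub bounded_linear_ident bounded_linear_const_scaleR)
  then show ?thesis
    using K by (intro exI[of _ K] exI[of _ "\<lambda>n. onorm (\<lambda>x. x - 2 *\<^sub>R K n x)"]) (auto intro: onorm)
qed

text \<open>\<open>K n\<close> is the partial sum projection. It has finite-dimensional range, and
  \<open>x - 2 *\<^sub>R K n x\<close> only flips the first \<open>n\<close> signs, so that
  \<open>c\<close> can be the constant \<open>1\<close>.\<close>

lemma unconditional_FDD_approximation:
  assumes "unconditional_FDD smul X"
  shows "\<exists>K c. (\<forall>n. K n \<in> compact_ops (type_space smul) (type_space smul)) \<and>
    (\<forall>x. (\<lambda>n. K n x) \<longlonglongrightarrow> x) \<and> (\<forall>n x. norm (x - 2 *\<^sub>R K n x) \<le> c n * norm x) \<and> c \<longlonglongrightarrow> 1"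
proof -
  obtain B where B: "\<And>n. finite (B n)" "\<And>n. X n = span (B n)"
    using assms unfolding unconditional_FDD_def by metis
  have ex1: "\<And>x. \<exists>!a. (\<forall>n. a n \<in> X n) \<and> a sums x"
    using assms by (auto simp: unconditional_FDD_def)
  then obtain A where A: "\<And>x n. A x n \<in> X n" "\<And>x. A x sums x" by metis
  have A_eq: "A x = a" if "\<And>n. a n \<in> X n" "a sums x" for x a
    using ex1[of x] A that by blast
  \<comment> \<open>Linearity of the coordinates comes from uniqueness of the expansion.\<close>
  have A_add: "A (x + y) = (\<lambda>n. A x n + A y n)" for x y
    by (intro A_eq sums_add A) (use A in \<open>auto simp: B intro: span_add\<close>)
  have A_scale: "A (smul c x) = (\<lambda>n. smul c (A x n))" for c x
    by (intro A_eq bounded_linear.sums[OF bounded_linear_scale] A)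
      (use A in \<open>auto simp: B intro: span_scale\<close>)
  have sym: "norm (x - 2 *\<^sub>R (\<Sum>i<n. A x i)) = norm x" for n x
  proof -
    define \<theta> where "\<theta> i = (if i < n then -1 else 1 :: real)" for i
    have "(\<lambda>i. A x i - 2 *\<^sub>R (if i \<in> {..<n} then A x i else 0)) sums (x - 2 *\<^sub>R (\<Sum>i<n. A x i))"
      by (intro sums_diff sums_scaleR_right A sums_If_finite_set) auto
    moreover have "(\<lambda>i. A x i - 2 *\<^sub>R (if i \<in> {..<n} then A x i else 0)) = (\<lambda>i. \<theta> i *\<^sub>R A x i)"
      by (auto simp: \<theta>_def fun_eq_iff scaleR_2)
    ultimately have "(\<Sum>i. \<theta> i *\<^sub>R A x i) = x - 2 *\<^sub>R (\<Sum>i<n. A x i)" by (simp add: sums_iff)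
    moreover have "norm (\<Sum>i. \<theta> i *\<^sub>R A x i) = norm x"
      using assms A by (auto simp: unconditional_FDD_def \<theta>_def)
    ultimately show ?thesis by simp
  qed
  have bd: "norm (\<Sum>i<n. A x i) \<le> norm x" for n x
  proof -
    have "norm (2 *\<^sub>R (\<Sum>i<n. A x i)) = norm (x - (x - 2 *\<^sub>R (\<Sum>i<n. A x i)))" by simp
    also have "\<dots> \<le> norm x + norm x" using norm_triangle_ineq4 sym by metis
    finally show ?thesis by simp
  qed
  interpret nspace_pair "type_space smul" "type_space smul"
    by (simp add: nspace_pair_def normed_nspace_type_space)
  define K where "K n x = (\<Sum>i<n. A x i)" for n x
  have "K n \<in> compact_ops (type_space smul) (type_space smul)" for n
    unfolding compact_ops_def
  proof (intro CollectI conjI allI impI)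
    show "K n \<in> carr (op_space (type_space smul) (type_space smul))"
      by (rule op_spaceI[where C = 1])
        (auto simp: K_def A_add A_scale sum.distrib scale_sum_right bd)
    fix x :: "nat \<Rightarrow> 'a"
    assume x: "\<forall>j. x j \<in> carr (type_space smul) \<and> nrm (type_space smul) (x j) \<le> 1"
    have "K n (x j) \<in> span (\<Union>i<n. B i)" for j
      unfolding K_def using A(1) span_mono[of "B i" "\<Union>i<n. B i" for i]
      by (intro span_sum) (force simp: B)
    moreover have "norm (K n (x j)) \<le> 1" for j
      using bd[of "x j" n] x by (auto simp: K_def intro: order_trans)
    ultimately obtain y r where "strict_mono r" "(\<lambda>j. K n (x (r j))) \<longlonglongrightarrow> y"
      using bounded_span_convergent_subsequence[of "\<Union>i<n. B i" "\<lambda>j. K n (x j)" 1] B by auto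
    then show "\<exists>y\<in>carr (type_space smul). \<exists>r. strict_mono r \<and>
        (\<lambda>j. nrm (type_space smul) (K n (x (r j)) - y)) \<longlonglongrightarrow> 0"
      by (auto simp: LIM_zero_iff tendsto_norm_zero_iff)
  qed
  moreover have "(\<lambda>n. K n x) \<longlonglongrightarrow> x" for x
    using A(2)[of x] by (simp add: K_def sums_def)
  ultimately show ?thesis
    using sym by (intro exI[of _ K] exI[of _ "\<lambda>_. 1"]) (simp add: K_def)
qed

end

section \<open>Operators into \<open>\<ell>\<^sub>p\<close>\<close>

text \<open>The domain enters only through Clarkson's inequality, the smoothness estimate and the
  approximating operators. The normalisation \<open>1 \<le> c n\<close> lets the bound
  \<open>c n * norm x\<close> cover the identity too.\<close>

locale unconditional_approximation = banach_over smul
  for smul :: "'k::{real_normed_field, euclidean_space} \<Rightarrow> 'a::banach \<Rightarrow> 'a" +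
  fixes p D :: real and K :: "nat \<Rightarrow> 'a \<Rightarrow> 'a" and c :: "nat \<Rightarrow> real"
  assumes p: "1 \<le> p" and D: "0 \<le> D"
    and clarkson: "2 * (norm x powr p + norm y powr p) \<le> norm (x + y) powr p + norm (x - y) powr p"
    and smooth: "0 \<le> t \<Longrightarrow> t \<le> 1 \<Longrightarrow> norm x \<le> 1 \<Longrightarrow> norm y \<le> 1 \<Longrightarrow>
      norm (x + t *\<^sub>R y) + norm (x - t *\<^sub>R y) \<le> 2 + D * t\<^sup>2"
    and K_compact: "K n \<in> compact_ops (type_space smul) (type_space smul)"
    and K_lim: "(\<lambda>n. K n x) \<longlonglongrightarrow> x"
    and K_sym: "norm (x - 2 *\<^sub>R K n x) \<le> c n * norm x"
    and c_lim: "c \<longlonglongrightarrow> 1" and c_ge_1: "1 \<le> c n"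
begin

lemmas K_props = compact_op_props[OF K_compact]

text \<open>\<open>K n\<close> and its complement are half the difference and half the sum of the
  identity and \<open>x - 2 *\<^sub>R K n x\<close>.\<close>

lemma norm_K_le: "norm (K n x) \<le> c n * norm x"
  and norm_diff_K_le: "norm (x - K n x) \<le> c n * norm x"
proof -
  have *: "norm x \<le> c n * norm x" using mult_right_mono[OF c_ge_1[of n] norm_ge_zero[of x]] by simp
  have "2 * norm (K n x) = norm (x - (x - 2 *\<^sub>R K n x))" by simp
  also have "\<dots> \<le> norm x + c n * norm x" using norm_triangle_ineq4 K_sym add_left_mono order_trans by meson
  finally show "norm (K n x) \<le> c n * norm x" using * by simp
  have "x + (x - 2 *\<^sub>R K n x) = 2 *\<^sub>R (x - K n x)" by (simp add: scaleR_2 algebra_simps)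
  then have "2 * norm (x - K n x) = norm (x + (x - 2 *\<^sub>R K n x))" by simp
  also have "\<dots> \<le> norm x + c n * norm x" using norm_triangle_ineq K_sym add_left_mono order_trans by meson
  finally show "norm (x - K n x) \<le> c n * norm x" using * by simp
qed

text \<open>Writing \<open>2 f (K n x\<^sub>0) + 2 t f (y - K n y) = f (x\<^sub>0 + t y) + (2 f (K n z) - f z)\<close> with
  \<open>z = x\<^sub>0 - t y\<close>, where both functionals have norm at most \<open>c n * norm f\<close>, the smoothness of the norm
  bounds the second summand on the left, if \<open>f\<close> almost attains its norm at \<open>x\<^sub>0\<close>.\<close>

lemma functional_uniform:
  assumes add: "\<And>x y. f (x + y) = f x + f y" and scale: "\<And>a x. f (smul a x) = a * f x"
    and bd: "\<And>x. norm (f x) \<le> C * norm x" and \<delta>: "0 < \<delta>"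
  shows "eventually (\<lambda>n. \<forall>y. norm y \<le> 1 \<longrightarrow> norm (f (y - K n y)) \<le> \<delta>) sequentially"
proof -
  interpret P: nspace_pair "type_space smul" "type_space ((*) :: 'k \<Rightarrow> 'k \<Rightarrow> 'k)"
    by (simp add: nspace_pair_def normed_nspace_type_space normed_nspace_field)
  have f: "f \<in> carr (op_space (type_space smul) (type_space (*)))"
    by (rule P.op_spaceI[where C = C]) (simp_all add: add scale bd)
  define N where "N = op_norm (type_space smul) (type_space (*)) f"
  have N0: "0 \<le> N" using P.op_norm_nonneg[OF f] by (simp add: N_def)
  have N: "norm (f x) \<le> N * norm x" for x using P.op_norm_bound[OF f, of x] by (simp add: N_def)
  have f_scaleR: "f (t *\<^sub>R x) = of_real t * f x" for t x
    using scale[of "of_real t" x] by (simp add: scale_of_real)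
  have f_diff: "f (x - y) = f x - f y" for x y
    using add[of "x - y" y] by simp
  \<comment> \<open>The final estimate is
    \<open>t * norm w \<le> \<eta> * (N + 2) + N * D * t * t\<close>. Here \<open>t\<close> makes
    the last term at most \<open>t * \<delta> / 2\<close>, and afterwards \<open>\<eta>\<close>,
    depending on \<open>t\<close>, does the same for the other.\<close>
  define t where "t = min 1 (\<delta> / (2 * (N * D + 1)))"
  have ND: "0 \<le> N * D" using N0 D by simp
  have t: "0 < t" "t \<le> 1" using \<delta> ND by (auto simp: t_def)
  have "(N * D + 1) * t \<le> (N * D + 1) * (\<delta> / (2 * (N * D + 1)))"
    using ND by (intro mult_left_mono) (auto simp: t_def)
  also have "\<dots> = \<delta> / 2" using ND by (simp add: divide_simps)
  finally have NDt: "N * D * t \<le> \<delta> / 2" using t by (simp add: distrib_right)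
  define \<eta> where "\<eta> = min 1 (t * \<delta> / (2 * (N + 2)))"
  have \<eta>: "0 < \<eta>" "\<eta> \<le> 1" using \<delta> t N0 by (auto simp: \<eta>_def)
  have "\<eta> * (N + 2) \<le> t * \<delta> / (2 * (N + 2)) * (N + 2)"
    using N0 by (intro mult_right_mono) (auto simp: \<eta>_def)
  also have "\<dots> = t * \<delta> / 2" using N0 by (simp add: divide_simps)
  finally have \<eta>N: "\<eta> * (N + 2) \<le> t * \<delta> / 2" .
  have "\<exists>x0. norm x0 \<le> 1 \<and> N - \<eta> < norm (f x0)"
  proof (rule ccontr)
    assume "\<not> ?thesis"
    then have "N \<le> N - \<eta>" unfolding N_def by (intro P.op_norm_le) (auto simp: not_less)
    then show False using \<eta> by simp
  qed
  then obtain x0 where x0: "norm x0 \<le> 1" "N - \<eta> < norm (f x0)" by blast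
  have "bounded_linear f"
    by (rule bounded_linear_intro[of _ C]) (simp_all add: add f_scaleR bd scaleR_conv_of_real mult.commute)
  then have "(\<lambda>n. f (K n x0)) \<longlonglongrightarrow> f x0" by (rule bounded_linear.tendsto[OF _ K_lim])
  then have ev1: "eventually (\<lambda>n. norm (f (K n x0) - f x0) < \<eta>) sequentially"
    using \<eta> by (auto dest: tendstoD simp: dist_norm)
  have ev2: "eventually (\<lambda>n. c n < 1 + \<eta>) sequentially"
    using order_tendstoD(2)[OF c_lim, of "1 + \<eta>"] \<eta> by simp
  show ?thesis
    using ev1 ev2
  proof eventually_elim
    case (elim n)
    show ?case
    proof (intro allI impI)
      fix y' :: 'a assume y': "norm y' \<le> 1"
      define w where "w = f (y' - K n y')"
      \<comment> \<open>Rotating \<open>y'\<close> by \<open>a\<close> aligns the value at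
        \<open>y' - K n y'\<close> with the value at \<open>x0\<close>, so that the two absolute
        values add up.\<close>
      obtain a where a: "norm a = 1" "norm (f x0 + a * (of_real t * w)) = norm (f x0) + norm (of_real t * w)"
        using exists_unimodular_aligned .
      define y where "y = smul a y'"
      have y: "norm y \<le> 1" using y' a by (simp add: y_def norm_scale)
      have fy: "f (y - K n y) = a * w"
        by (simp add: y_def K_props(2) w_def flip: scale_right_diff_distrib scale)
      define z where "z = x0 - t *\<^sub>R y"
      have Kz: "K n z = K n x0 - t *\<^sub>R K n y"
        unfolding z_def using linear_diff[OF bounded_linear.linear[OF K_props(4)[of n]]] by (simp add: K_props(3))
      have "f (x0 + t *\<^sub>R y) - f (z - 2 *\<^sub>R K n z) = 2 * f (K n x0) + 2 * (of_real t * (a * w))"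
        unfolding Kz fy[symmetric] by (simp add: z_def add f_diff f_scaleR algebra_simps)
      then have "norm (2 * (f (K n x0) + of_real t * (a * w))) \<le> norm (f (x0 + t *\<^sub>R y)) + norm (f (z - 2 *\<^sub>R K n z))"
        by (metis distrib_left norm_triangle_ineq4)
      also have "\<dots> \<le> N * (c n * norm (x0 + t *\<^sub>R y)) + N * (c n * norm z)"
      proof (rule add_mono)
        have "norm (f (x0 + t *\<^sub>R y)) \<le> N * norm (x0 + t *\<^sub>R y)" by (rule N)
        also have "\<dots> \<le> N * (c n * norm (x0 + t *\<^sub>R y))"
          using mult_right_mono[OF c_ge_1[of n] norm_ge_zero[of "x0 + t *\<^sub>R y"]] N0
          by (intro mult_left_mono) auto
        finally show "norm (f (x0 + t *\<^sub>R y)) \<le> N * (c n * norm (x0 + t *\<^sub>R y))" .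
        have "norm (f (z - 2 *\<^sub>R K n z)) \<le> N * norm (z - 2 *\<^sub>R K n z)" by (rule N)
        also have "\<dots> \<le> N * (c n * norm z)" using N0 K_sym by (intro mult_left_mono) auto
        finally show "norm (f (z - 2 *\<^sub>R K n z)) \<le> N * (c n * norm z)" .
      qed
      also have "\<dots> = N * c n * (norm (x0 + t *\<^sub>R y) + norm (x0 - t *\<^sub>R y))"
        by (simp add: z_def algebra_simps)
      also have "\<dots> \<le> N * c n * (2 + D * t\<^sup>2)"
        using N0 c_ge_1[of n] t x0 y by (intro mult_left_mono smooth) auto
      also have "\<dots> \<le> N * ((1 + \<eta>) * (2 + D * t\<^sup>2))"
        using N0 elim D by (auto simp: mult.assoc intro!: mult_left_mono mult_right_mono)
      also have "(1 + \<eta>) * (2 + D * t\<^sup>2) = 2 + 2 * \<eta> + D * t\<^sup>2 + \<eta> * (D * t\<^sup>2)"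
        by (simp add: algebra_simps)
      \<comment> \<open>The mixed term is absorbed by \<open>\<eta> \<le> 1\<close>.\<close>
      also have "N * \<dots> \<le> N * (2 + 2 * \<eta> + D * t\<^sup>2 + 1 * (D * t\<^sup>2))"
        using N0 D \<eta> by (intro mult_left_mono add_left_mono mult_right_mono) auto
      also have "N * (2 + 2 * \<eta> + D * t\<^sup>2 + 1 * (D * t\<^sup>2)) = 2 * (N + N * \<eta> + N * D * t * t)"
        by (simp add: power2_eq_square algebra_simps)
      finally have up: "norm (f (K n x0) + of_real t * (a * w)) \<le> N + N * \<eta> + N * D * t * t"
        by (simp only: norm_mult norm_numeral) simp
      have "N - \<eta> + t * norm w \<le> norm (f x0 + a * (of_real t * w))"
        unfolding a(2) using x0 t by (simp add: norm_mult)
      also have "f x0 + a * (of_real t * w) = f (K n x0) + of_real t * (a * w) - (f (K n x0) - f x0)"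
        by (simp add: algebra_simps)
      also have "norm \<dots> \<le> N + N * \<eta> + N * D * t * t + \<eta>"
        using up elim(1) norm_triangle_ineq4[of "f (K n x0) + of_real t * (a * w)" "f (K n x0) - f x0"] by linarith
      finally have "t * norm w \<le> \<eta> * (N + 2) + N * D * t * t" by (simp add: algebra_simps)
      also have "\<dots> \<le> t * \<delta> / 2 + \<delta> / 2 * t"
        using \<eta>N NDt t by (intro add_mono mult_right_mono) auto
      also have "\<dots> = t * \<delta>" by simp
      finally show "norm (f (y' - K n y')) \<le> \<delta>" using t by (simp add: w_def)
    qed
  qed
qed

section \<open>Operators from \<open>X\<close> into \<open>ell p\<close> composed with the
  approximating operators\<close>

abbreviation "X \<equiv> type_space smul"
abbreviation "Y \<equiv> ell p :: ('k, nat \<Rightarrow> 'k) nspace"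

sublocale pair: nspace_pair X Y
  by (simp add: nspace_pair_def normed_nspace_type_space normed_nspace_ell p)

text \<open>\<open>functional_uniform\<close> is applied to each of the first \<open>M\<close>
  coordinate functionals of \<open>T\<close>, with error \<open>\<delta> / (real M + 1)\<close>; the
  denominator is positive even for \<open>M = 0\<close>.\<close>

lemma head_part_uniform:
  assumes T: "T \<in> carr (op_space X Y)" and \<delta>: "0 < \<delta>"
  shows "eventually (\<lambda>n. \<forall>y. norm y \<le> 1 \<longrightarrow> nrm Y (head_part M (T (y - K n y))) \<le> \<delta>) sequentially"
proof -
  have mem: "T x \<in> carr Y" for x using pair.op_mem[OF T] by simp
  have "eventually (\<lambda>n. \<forall>y. norm y \<le> 1 \<longrightarrow> norm (T (y - K n y) i) \<le> \<delta> / (real M + 1)) sequentially" for i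
  proof (rule functional_uniform)
    show "T (x + y) i = T x i + T y i" for x y using pair.op_add[OF T] by simp
    show "T (smul a x) i = a * T x i" for a x using pair.op_scl[OF T, of x a] by (simp add: scl_ell)
    show "norm (T x i) \<le> op_norm X Y T * norm x" for x
      using norm_le_nrm_ell[OF p mem, of x i] pair.op_norm_bound[OF T, of x] by simp
  qed (use \<delta> in simp)
  then have "eventually (\<lambda>n. \<forall>i\<in>{..<M}. \<forall>y. norm y \<le> 1 \<longrightarrow> norm (T (y - K n y) i) \<le> \<delta> / (real M + 1)) sequentially"
    by (intro eventually_ball_finite) auto
  then show ?thesis
  proof eventually_elim
    case (elim n)
    show ?case
    proof (intro allI impI)
      fix y :: 'a assume y: "norm y \<le> 1"
      have "nrm Y (head_part M (T (y - K n y))) \<le> (\<Sum>i<M. norm (T (y - K n y) i))"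
        by (rule nrm_head_part_le_sum[OF p mem])
      also have "\<dots> \<le> (\<Sum>i<M. \<delta> / (real M + 1))" using elim y by (intro sum_mono) auto
      also have "\<dots> = real M * \<delta> / (real M + 1)" by simp
      also have "\<dots> \<le> \<delta>" using \<delta> by (simp add: field_simps)
      finally show "nrm Y (head_part M (T (y - K n y))) \<le> \<delta>" .
    qed
  qed
qed

text \<open>Radius \<open>2\<close> is chosen because \<open>x - K n x\<close> has norm at most
  \<open>c n < 2\<close> for \<open>x\<close> in the unit ball and large \<open>n\<close>.\<close>

lemma compact_op_tail:
  assumes S: "S \<in> compact_ops X Y" and e: "0 < e"
  obtains M where "\<And>x. norm x \<le> 2 \<Longrightarrow> nrm Y (tail_part M (S x)) \<le> e"
proof -
  have op: "S \<in> carr (op_space X Y)" using S by (simp add: compact_ops_def)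
  obtain M where "\<forall>x\<in>carr X. nrm X x \<le> 1 \<longrightarrow> nrm Y (tail_part M (S x)) \<le> e / 2"
    using S e unfolding compact_ops_ell_iff[OF normed_nspace_type_space p] by (meson half_gt_zero)
  then have M: "nrm Y (tail_part M (S x)) \<le> e / 2" if "norm x \<le> 1" for x
    using that by simp
  have "nrm Y (tail_part M (S x)) \<le> e" if x: "norm x \<le> 2" for x
  proof -
    define u where "u = smul (of_real (1 / 2)) x"
    have u: "norm u \<le> 1" unfolding u_def scale_of_real using x by simp
    have "x = smul 2 u" by (simp add: u_def)
    then have "S x = scl Y 2 (S u)" using pair.op_scl[OF op, of u 2] by simp
    then have "tail_part M (S x) = scl Y 2 (tail_part M (S u))" by (simp add: scl_ell tail_part_scl)
    then have "nrm Y (tail_part M (S x)) = 2 * nrm Y (tail_part M (S u))"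
      using pair.cod.nrm_scl[OF tail_part_ell[OF p pair.op_mem[OF op, of u]], of 2 M] by simp
    then show ?thesis using M[OF u] by simp
  qed
  then show ?thesis by (rule that)
qed

lemma comp_K_compact:
  assumes T: "T \<in> carr (op_space X Y)"
  shows "(\<lambda>x. T (K n x)) \<in> compact_ops X Y"
  unfolding compact_ops_def
proof (intro CollectI conjI allI impI)
  show "(\<lambda>x. T (K n x)) \<in> carr (op_space X Y)"
  proof (rule pair.op_spaceI)
    fix x
    have "nrm Y (T (K n x)) \<le> op_norm X Y T * norm (K n x)" using pair.op_norm_bound[OF T, of "K n x"] by simp
    also have "\<dots> \<le> op_norm X Y T * (c n * norm x)"
      using pair.op_norm_nonneg[OF T] norm_K_le by (intro mult_left_mono) auto
    finally show "nrm Y (T (K n x)) \<le> (op_norm X Y T * c n) * nrm X x" by (simp add: mult.assoc)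
  qed (use pair.op_mem[OF T] pair.op_add[OF T] pair.op_scl[OF T] in \<open>auto simp: K_props(1,2)\<close>)
  fix x :: "nat \<Rightarrow> 'a" assume "\<forall>j. x j \<in> carr X \<and> nrm X (x j) \<le> 1"
  then have "\<exists>y\<in>carr X. \<exists>r. strict_mono r \<and> (\<lambda>j. nrm X (K n (x (r j)) - y)) \<longlonglongrightarrow> 0"
    using K_compact[of n] by (simp add: compact_ops_def)
  then obtain y r where r: "strict_mono r" "(\<lambda>j. norm (K n (x (r j)) - y)) \<longlonglongrightarrow> 0" by auto
  have "(\<lambda>j. nrm Y (T (K n (x (r j))) - T y)) \<longlonglongrightarrow> 0"
  proof (rule Lim_null_comparison)
    have "norm (nrm Y (T (K n (x (r j))) - T y)) \<le> op_norm X Y T * norm (K n (x (r j)) - y)" for j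
      using pair.op_norm_bound[OF T, of "K n (x (r j)) - y"] pair.op_diff[OF T, of "K n (x (r j))" y]
        nrm_ell_nonneg[OF p, of "T (K n (x (r j))) - T y"] by simp
    then show "\<forall>\<^sub>F j in sequentially. norm (nrm Y (T (K n (x (r j))) - T y)) \<le> op_norm X Y T * norm (K n (x (r j)) - y)"
      by simp
    show "(\<lambda>j. op_norm X Y T * norm (K n (x (r j)) - y)) \<longlonglongrightarrow> 0"
      using tendsto_mult_left[OF r(2), of "op_norm X Y T"] by simp
  qed
  then show "\<exists>y\<in>carr Y. \<exists>r. strict_mono r \<and> (\<lambda>j. nrm Y (T (K n (x (r j))) - y)) \<longlonglongrightarrow> 0"
    using r(1) pair.op_mem[OF T, of y] by (intro bexI[of _ "T y"] exI[of _ r]) auto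
qed

text \<open>At \<open>x - K n x\<close> the first \<open>M\<close> coordinates of \<open>S\<close>
  are small by \<open>head_part_uniform\<close>, and the remaining ones by compactness of
  \<open>S\<close>.\<close>

lemma compact_op_comp_K_tendsto:
  assumes S: "S \<in> compact_ops X Y"
  shows "(\<lambda>n. op_norm X Y (S - (\<lambda>x. S (K n x)))) \<longlonglongrightarrow> 0"
proof (rule LIMSEQ_I)
  fix e :: real assume e: "0 < e"
  have op: "S \<in> carr (op_space X Y)" using S by (simp add: compact_ops_def)
  interpret L: normed_nspace "op_space X Y" by (rule pair.normed_nspace_op_space)
  obtain M where M: "\<And>x. norm x \<le> 2 \<Longrightarrow> nrm Y (tail_part M (S x)) \<le> e / 3"
    using compact_op_tail[OF S, of "e / 3"] e by auto
  have 1: "eventually (\<lambda>n. \<forall>y. norm y \<le> 1 \<longrightarrow> nrm Y (head_part M (S (y - K n y))) \<le> e / 3) sequentially"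
    using e by (intro head_part_uniform op) auto
  have 2: "eventually (\<lambda>n. c n < 2) sequentially" using order_tendstoD(2)[OF c_lim, of 2] by simp
  from 1 2 have "eventually (\<lambda>n. norm (op_norm X Y (S - (\<lambda>x. S (K n x))) - 0) < e) sequentially"
  proof eventually_elim
    case (elim n)
    have "op_norm X Y (S - (\<lambda>x. S (K n x))) \<le> e / 3 + e / 3"
    proof (rule pair.op_norm_le)
      fix x assume "x \<in> carr X" "nrm X x \<le> 1"
      then have x: "norm x \<le> 1" by simp
      have w: "norm (x - K n x) \<le> 2"
        using norm_diff_K_le[of x n] mult_mono[of "c n" 2 "norm x" 1] elim(2) x by auto
      have m: "S (x - K n x) \<in> carr Y" using pair.op_mem[OF op] by simp
      have "(S - (\<lambda>x. S (K n x))) x = head_part M (S (x - K n x)) + tail_part M (S (x - K n x))"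
        unfolding head_add_tail using pair.op_diff[OF op] by simp
      then have "nrm Y ((S - (\<lambda>x. S (K n x))) x)
          \<le> nrm Y (head_part M (S (x - K n x))) + nrm Y (tail_part M (S (x - K n x)))"
        using minkowski[OF p head_part_ell[OF p m] tail_part_ell[OF p m]] by metis
      also have "\<dots> \<le> e / 3 + e / 3" using elim(1) x M[OF w] by (intro add_mono) auto
      finally show "nrm Y ((S - (\<lambda>x. S (K n x))) x) \<le> e / 3 + e / 3" .
    qed
    moreover have "(\<lambda>x. S (K n x)) \<in> carr (op_space X Y)"
      using comp_K_compact[OF op] by (simp add: compact_ops_def)
    then have "0 \<le> op_norm X Y (S - (\<lambda>x. S (K n x)))"
      by (intro pair.op_norm_nonneg L.carr_diff op)
    ultimately show ?case using e by simp
  qed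
  then show "\<exists>n0. \<forall>n\<ge>n0. norm (op_norm X Y (S - (\<lambda>x. S (K n x))) - 0) < e"
    by (simp add: eventually_sequentially)
qed

text \<open>Clarkson's inequality for \<open>K n x\<close> and \<open>x - K n x\<close>: their sum
  is \<open>x\<close>, and their difference is \<open>x - 2 *\<^sub>R K n x\<close> up to
  sign.\<close>

lemma norm_K_powr_le:
  assumes "norm x \<le> 1"
  shows "norm (K n x) powr p + norm (x - K n x) powr p \<le> (1 + c n powr p) / 2"
proof -
  have "2 * (norm (K n x) powr p + norm (x - K n x) powr p)
      \<le> norm (K n x + (x - K n x)) powr p + norm (K n x - (x - K n x)) powr p"
    by (rule clarkson)
  also have "norm (K n x - (x - K n x)) = norm (x - 2 *\<^sub>R K n x)"
    by (simp add: scaleR_2 norm_minus_commute algebra_simps)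
  also have "norm (K n x + (x - K n x)) powr p + \<dots> powr p \<le> 1 + c n powr p"
  proof (rule add_mono)
    show "norm (K n x + (x - K n x)) powr p \<le> 1" using assms p by (simp add: powr_le1)
    have "norm (x - 2 *\<^sub>R K n x) \<le> c n"
      using K_sym[of x n] mult_left_mono[OF assms, of "c n"] c_ge_1[of n] by linarith
    then show "norm (x - 2 *\<^sub>R K n x) powr p \<le> c n powr p" using p by (intro powr_mono2) auto
  qed
  finally show ?thesis by simp
qed

text \<open>The main term \<open>h\<close> has its two pieces on disjoint coordinates, so its norm
  is controlled by \<open>norm_K_powr_le\<close>. Three errors remain: the heads of
  \<open>T w\<close> and of \<open>S w\<close>, and the tail of \<open>S x\<close>. None of these
  bounds depends on \<open>a\<close>.\<close>

lemma operator_estimate: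
  assumes T: "T \<in> carr (op_space X Y)" "op_norm X Y T \<le> 1"
    and S: "S \<in> compact_ops X Y" "op_norm X Y S \<le> 1" and e: "0 < e"
  shows "eventually (\<lambda>n. \<forall>a. norm a = 1 \<longrightarrow>
    op_norm X Y (T - (\<lambda>x. T (K n x)) + (\<lambda>x. scl Y a (S x))) \<le> 1 + e) sequentially"
proof -
  have opS: "S \<in> carr (op_space X Y)" using S by (simp add: compact_ops_def)
  have mT: "T x \<in> carr Y" and mS: "S x \<in> carr Y" for x
    using pair.op_mem[OF T(1)] pair.op_mem[OF opS] by auto
  have nT: "nrm Y (T x) \<le> norm x" for x
    using pair.op_norm_bound[OF T(1), of x] mult_right_mono[OF T(2) norm_ge_zero[of x]] by simp
  have nS: "nrm Y (S x) \<le> norm x" for x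
    using pair.op_norm_bound[OF opS, of x] mult_right_mono[OF S(2) norm_ge_zero[of x]] by simp
  obtain M where M: "\<And>x. norm x \<le> 2 \<Longrightarrow> nrm Y (tail_part M (S x)) \<le> e / 4"
    using compact_op_tail[OF S(1), of "e / 4"] e by auto
  have 1: "eventually (\<lambda>n. \<forall>y. norm y \<le> 1 \<longrightarrow> nrm Y (head_part M (T (y - K n y))) \<le> e / 4) sequentially"
    using e by (intro head_part_uniform T) auto
  have 2: "eventually (\<lambda>n. \<forall>y. norm y \<le> 1 \<longrightarrow> nrm Y (head_part M (S (y - K n y))) \<le> e / 4) sequentially"
    using e by (intro head_part_uniform opS) auto
  \<comment> \<open>The limit is \<open>1\<close>, so the bound for \<open>h\<close> is eventually
    below \<open>1 + e / 4\<close>.\<close>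
  have "(\<lambda>n. ((1 + c n powr p) / 2) powr (1 / p)) \<longlonglongrightarrow> ((1 + 1 powr p) / 2) powr (1 / p)"
    by (intro tendsto_intros c_lim) auto
  then have 3: "eventually (\<lambda>n. ((1 + c n powr p) / 2) powr (1 / p) < 1 + e / 4) sequentially"
    using e by (intro order_tendstoD(2)) auto
  from 1 2 3 show ?thesis
  proof eventually_elim
    case (elim n)
    show ?case
    proof (intro allI impI pair.op_norm_le)
      fix a :: 'k and x :: 'a
      assume a: "norm a = 1" and "nrm X x \<le> 1"
      then have x: "norm x \<le> 1" by simp
      define w where "w = x - K n x"
      have sc: "scl Y a z \<in> carr Y" "nrm Y (scl Y a z) = nrm Y z" if "z \<in> carr Y" for z
        using that a by (auto simp: pair.cod.nrm_scl)
      define h where "h = head_part M (scl Y a (S (K n x))) + tail_part M (T w)"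
      have hm: "h \<in> carr Y" unfolding h_def
        by (intro ell_add_mem[OF p] head_part_ell[OF p] tail_part_ell[OF p] sc mT mS)
      have "nrm Y h powr p = nrm Y (head_part M (scl Y a (S (K n x)))) powr p + nrm Y (tail_part M (T w)) powr p"
        unfolding h_def by (intro nrm_head_add_tail[OF p] sc mT mS)
      also have "\<dots> \<le> norm (K n x) powr p + norm w powr p"
      proof (intro add_mono powr_mono2)
        show "nrm Y (head_part M (scl Y a (S (K n x)))) \<le> norm (K n x)"
          using nrm_head_part_le[OF p sc(1)[OF mS], of M "K n x"] sc(2)[OF mS, of "K n x"] nS[of "K n x"] by simp
        show "nrm Y (tail_part M (T w)) \<le> norm w"
          using nrm_tail_part_le[OF p mT, of M w] nT[of w] by simp
      qed (use p nrm_ell_nonneg[OF p] in auto)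
      also have "\<dots> \<le> (1 + c n powr p) / 2" unfolding w_def by (rule norm_K_powr_le[OF x])
      finally have "(nrm Y h powr p) powr (1 / p) \<le> ((1 + c n powr p) / 2) powr (1 / p)"
        using p by (intro powr_mono2) auto
      then have h: "nrm Y h \<le> 1 + e / 4"
        using p elim(3) nrm_ell_nonneg[OF p, of h] by (simp add: powr_powr)
      have "T x - T (K n x) = T w" unfolding w_def using pair.op_diff[OF T(1)] by simp
      moreover have "S x = S (K n x) + S w"
        unfolding w_def using pair.op_diff[OF opS] by simp
      \<comment> \<open>Both operators are cut at \<open>M\<close>: the head of \<open>S x\<close>
        is split further through \<open>x = K n x + w\<close>, while its tail is kept whole, as it
        is small already.\<close>
      ultimately have eq: "(T - (\<lambda>x. T (K n x)) + (\<lambda>x. scl Y a (S x))) x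
          = h + (head_part M (T w) + (scl Y a (head_part M (S w)) + scl Y a (tail_part M (S x))))"
        by (auto simp: h_def head_part_def tail_part_def scl_ell fun_eq_iff algebra_simps)
      have m: "head_part M (T w) \<in> carr Y" "scl Y a (head_part M (S w)) \<in> carr Y"
        "scl Y a (tail_part M (S x)) \<in> carr Y"
        by (intro head_part_ell[OF p] tail_part_ell[OF p] sc mT mS)+
      have "nrm Y ((T - (\<lambda>x. T (K n x)) + (\<lambda>x. scl Y a (S x))) x)
          \<le> nrm Y h + (nrm Y (head_part M (T w))
            + (nrm Y (scl Y a (head_part M (S w))) + nrm Y (scl Y a (tail_part M (S x)))))"
        unfolding eq
        using pair.cod.nrm_triangle[OF hm pair.cod.carr_add[OF m(1) pair.cod.carr_add[OF m(2,3)]]]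
          pair.cod.nrm_triangle[OF m(1) pair.cod.carr_add[OF m(2,3)]] pair.cod.nrm_triangle[OF m(2,3)]
        by linarith
      also have "\<dots> \<le> (1 + e / 4) + (e / 4 + (e / 4 + e / 4))"
        using h elim(1,2) x M[of x] sc(2)[OF head_part_ell[OF p mS]] sc(2)[OF tail_part_ell[OF p mS]]
        by (intro add_mono) (auto simp: w_def)
      also have "\<dots> = 1 + e" by simp
      finally show "nrm Y ((T - (\<lambda>x. T (K n x)) + (\<lambda>x. scl Y a (S x))) x) \<le> 1 + e" .
    qed
  qed
qed

text \<open>Precomposition with \<open>K n\<close> serves as the map \<open>R n\<close> of the
  criterion; it makes every operator compact and approximates the compact ones in norm.\<close>

theorem M_ideal_compact_ops: "M_ideal (op_space X Y) (compact_ops X Y)"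
proof (rule M_ideal_criterion[where R = "\<lambda>n T x. T (K n x)" and c = c])
  show "normed_nspace (op_space X Y)" by (rule pair.normed_nspace_op_space)
  show "closed_subspace (op_space X Y) (compact_ops X Y)"
    by (rule closed_subspace_compact_ops_ell[OF normed_nspace_type_space p])
  show "c \<longlonglongrightarrow> 1" by (rule c_lim)
  show "nrm (op_space X Y) (\<lambda>x. T (K n x)) \<le> c n * nrm (op_space X Y) T"
    if T: "T \<in> carr (op_space X Y)" for n T
    unfolding pair.nrm_op_space
  proof (rule pair.op_norm_le)
    fix x assume "x \<in> carr X" "nrm X x \<le> 1"
    then have "c n * norm x \<le> c n * 1" using c_ge_1[of n] by (intro mult_left_mono) auto
    then have "norm (K n x) \<le> c n" using norm_K_le[of n x] by simp
    then have "op_norm X Y T * norm (K n x) \<le> op_norm X Y T * c n"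
      using pair.op_norm_nonneg[OF T] by (rule mult_left_mono)
    then show "nrm Y (T (K n x)) \<le> c n * op_norm X Y T"
      using pair.op_norm_bound[OF T, of "K n x"] by (simp add: mult.commute)
  qed
  show "\<forall>\<^sub>F n in sequentially. \<forall>a. norm a = 1 \<longrightarrow>
      nrm (op_space X Y) (T - (\<lambda>x. T (K n x)) + scl (op_space X Y) a S) \<le> 1 + e"
    if "T \<in> carr (op_space X Y)" "S \<in> compact_ops X Y" "nrm (op_space X Y) T \<le> 1"
      "nrm (op_space X Y) S \<le> 1" "0 < e" for T S e
    using operator_estimate[of T S e] that by (simp only: pair.nrm_op_space pair.scl_op_space simp_thms)
qed (auto simp: plus_fun_def comp_K_compact compact_op_comp_K_tendsto)

end

theorem corollary2p2:
  fixes p :: real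
    and smul :: "'k::{real_normed_field, euclidean_space} \<Rightarrow> 'a::banach \<Rightarrow> 'a"
  assumes "2 \<le> p"
    and "banach_over smul"
    and "subspace_of_quotient_of_Lp p smul"
    and "(\<exists>X. unconditional_FDD smul X) \<or> UMCAP smul"
  shows "M_ideal (op_space (type_space smul) (ell p)) (compact_ops (type_space smul) (ell p))"
proof -
  interpret banach_over smul by fact
  obtain K c where K: "\<And>n. K n \<in> compact_ops (type_space smul) (type_space smul)"
    "\<And>x. (\<lambda>n. K n x) \<longlonglongrightarrow> x" "\<And>n x. norm (x - 2 *\<^sub>R K n x) \<le> c n * norm x" "c \<longlonglongrightarrow> 1"
    using assms(4) UMCAP_approximation unconditional_FDD_approximation by metis
  \<comment> \<open>Replacing \<open>c n\<close> by its maximum with \<open>1\<close> provides the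
    normalisation of the locale without changing the limit.\<close>
  interpret unconditional_approximation smul p "smooth_const p" K "\<lambda>n. max 1 (c n)"
  proof
    show "(\<lambda>n. max 1 (c n)) \<longlonglongrightarrow> 1" using tendsto_max[OF tendsto_const K(4), of 1] by simp
    show "norm (x - 2 *\<^sub>R K n x) \<le> max 1 (c n) * norm x" for x n
      using K(3)[of x n] mult_right_mono[of "c n" "max 1 (c n)" "norm x"] by simp
    show "2 * (norm x powr p + norm y powr p) \<le> norm (x + y) powr p + norm (x - y) powr p" for x y :: 'a
      by (rule subspace_of_quotient_clarkson) fact+
    show "norm (x + t *\<^sub>R y) + norm (x - t *\<^sub>R y) \<le> 2 + smooth_const p * t\<^sup>2"
      if "0 \<le> t" "t \<le> 1" "norm x \<le> 1" "norm y \<le> 1" for t and x y :: 'a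
      by (rule subspace_of_quotient_smooth) fact+
  qed (use assms K smooth_const_nonneg in auto)
  show ?thesis by (rule M_ideal_compact_ops)
qed

end
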